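(* Let $n\in\mathbb{N}$, $2\le p<\infty$, $\Omega=\mathbb{R}\times[0,1]^n\subset\mathbb{R}^{n+1}$, and let $\phi:\mathbb{R}\to\mathbb{R}$ be ReLU, ELU, Softplus, or LeakyReLU. Then $$\overline{\mathcal{S}_{n+1}(\phi)\cap L^p(\Omega)}=L^p(\Omega),$$ where the closure is taken in $L^p(\Omega)$.
   Context: For a function $\phi:\mathbb{R}\to\mathbb{R}$ and an integer $m\ge1$, $\mathcal{S}_m(\phi)$ denotes the set of all functions on $\mathbb{R}^m$ of the form $x\mapsto\sum_{i=1}^k t_i\,\phi(\langle y_i,x\rangle+\varrho_i)$ with $k\in\mathbb{N}$, $t_i,\varrho_i\in\mathbb{R}$, $y_i\in\mathbb{R}^m$ (dot product $\langle\cdot,\cdot\rangle$). For $\Omega\subset\mathbb{R}^m$, $\mathcal{S}_m(\phi)\cap L^p(\Omega)$ denotes the set of elements of $\mathcal{S}_m(\phi)$ whose restriction to $\Omega$ lies in $L^p(\Omega)$ (Lebesgue measure, real-valued functions), identified with those restrictions. Activation functions: $\mathrm{ReLU}(x)=x$ if $x>0$ and $0$ if $x\le0$; $\mathrm{ELU}(x)=x$ if $x>0$ and $\alpha(e^x-1)$ if $x\le 0$, with $\alpha$ a real parameter; $\mathrm{Softplus}(x)=\log(e^x+1)$; $\mathrm{LeakyReLU}(x)=x$ if $x>0$ and $\alpha x$ if $x\le0$, with $\alpha$ a real parameter, $\alpha\ne1$. *)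

theory Defs
  imports "HOL-Analysis.Analysis"
begin

section \<open>The space \<open>L\<^sup>p\<close>\<close>

definition Lp_fun :: "real \<Rightarrow> 'a measure \<Rightarrow> ('a \<Rightarrow> real) set" where
  "Lp_fun p M = {f \<in> borel_measurable M. integrable M (\<lambda>x. \<bar>f x\<bar> powr p)}"

definition Lp_norm :: "real \<Rightarrow> 'a measure \<Rightarrow> ('a \<Rightarrow> real) \<Rightarrow> real" where
  "Lp_norm p M f = (\<integral>x. \<bar>f x\<bar> powr p \<partial>M) powr (1 / p)"

definition Lp_rel :: "real \<Rightarrow> 'a measure \<Rightarrow> (('a \<Rightarrow> real) \<times> ('a \<Rightarrow> real)) set" where
  "Lp_rel p M = {(f, g). f \<in> Lp_fun p M \<and> g \<in> Lp_fun p M \<and> (AE x in M. f x = g x)}"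

definition Lp_class :: "real \<Rightarrow> 'a measure \<Rightarrow> ('a \<Rightarrow> real) \<Rightarrow> ('a \<Rightarrow> real) set" where
  "Lp_class p M f = Lp_rel p M `` {f}"

definition Lp_space :: "real \<Rightarrow> 'a measure \<Rightarrow> ('a \<Rightarrow> real) set set" where
  "Lp_space p M = Lp_fun p M // Lp_rel p M"

text \<open>The chosen representatives do not matter: see \<open>Lp_dist_class\<close> below.\<close>

definition Lp_dist :: "real \<Rightarrow> 'a measure \<Rightarrow> ('a \<Rightarrow> real) set \<Rightarrow> ('a \<Rightarrow> real) set \<Rightarrow> real" where
  "Lp_dist p M F G = Lp_norm p M (\<lambda>x. (SOME f. f \<in> F) x - (SOME g. g \<in> G) x)"

abbreviation Lp_topology :: "real \<Rightarrow> 'a measure \<Rightarrow> ('a \<Rightarrow> real) set topology" where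
  "Lp_topology p M \<equiv> Metric_space.mtopology (Lp_space p M) (Lp_dist p M)"

lemma equiv_Lp_rel: "equiv (Lp_fun p M) (Lp_rel p M)"
proof (rule equivI)
  show "refl_on (Lp_fun p M) (Lp_rel p M)"
    by (auto simp: refl_on_def Lp_rel_def)
  show "sym (Lp_rel p M)"
    by (auto simp: sym_def Lp_rel_def)
  show "trans (Lp_rel p M)"
    by (auto simp: trans_def Lp_rel_def elim: AE_mp)
  show "Lp_rel p M \<subseteq> Lp_fun p M \<times> Lp_fun p M"
    by (auto simp: Lp_rel_def)
qed

lemma Lp_class_in_space: "f \<in> Lp_fun p M \<Longrightarrow> Lp_class p M f \<in> Lp_space p M"
  by (auto simp: Lp_class_def Lp_space_def quotient_def)

lemma Lp_space_cases:
  assumes "F \<in> Lp_space p M"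
  obtains f where "f \<in> Lp_fun p M" "F = Lp_class p M f"
  using assms by (auto simp: Lp_class_def Lp_space_def quotient_def)

lemma Lp_class_eq_iff:
  assumes "f \<in> Lp_fun p M" "g \<in> Lp_fun p M"
  shows "Lp_class p M f = Lp_class p M g \<longleftrightarrow> (AE x in M. f x = g x)"
  using eq_equiv_class_iff[OF equiv_Lp_rel assms] assms
  by (simp add: Lp_class_def Lp_rel_def)

lemma Lp_class_some:
  assumes "f \<in> Lp_fun p M"
  shows "(SOME g. g \<in> Lp_class p M f) \<in> Lp_fun p M"
    and "AE x in M. f x = (SOME g. g \<in> Lp_class p M f) x"
proof -
  have "f \<in> Lp_class p M f"
    using assms by (auto simp: Lp_class_def Lp_rel_def)
  hence "(SOME g. g \<in> Lp_class p M f) \<in> Lp_class p M f"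
    by (rule someI[where P = "\<lambda>g. g \<in> Lp_class p M f"])
  thus "(SOME g. g \<in> Lp_class p M f) \<in> Lp_fun p M"
    and "AE x in M. f x = (SOME g. g \<in> Lp_class p M f) x"
    by (auto simp: Lp_class_def Lp_rel_def)
qed

lemma Lp_norm_cong_AE:
  assumes "f \<in> borel_measurable M" "g \<in> borel_measurable M" "AE x in M. f x = g x"
  shows "Lp_norm p M f = Lp_norm p M g"
proof -
  have "(\<integral>x. \<bar>f x\<bar> powr p \<partial>M) = (\<integral>x. \<bar>g x\<bar> powr p \<partial>M)"
    using assms by (intro integral_cong_AE) auto
  thus ?thesis by (simp add: Lp_norm_def)
qed

lemma Lp_dist_class:
  assumes "f \<in> Lp_fun p M" "g \<in> Lp_fun p M"
  shows "Lp_dist p M (Lp_class p M f) (Lp_class p M g) = Lp_norm p M (\<lambda>x. f x - g x)"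
  unfolding Lp_dist_def
proof (rule Lp_norm_cong_AE)
  let ?f = "SOME h. h \<in> Lp_class p M f" and ?g = "SOME h. h \<in> Lp_class p M g"
  have [measurable]: "?f \<in> borel_measurable M" "?g \<in> borel_measurable M"
    "f \<in> borel_measurable M" "g \<in> borel_measurable M"
    using Lp_class_some(1)[OF assms(1)] Lp_class_some(1)[OF assms(2)] assms
    by (auto simp: Lp_fun_def)
  show "(\<lambda>x. ?f x - ?g x) \<in> borel_measurable M" "(\<lambda>x. f x - g x) \<in> borel_measurable M"
    by measurable
  show "AE x in M. ?f x - ?g x = f x - g x"
    using Lp_class_some(2)[OF assms(1)] Lp_class_some(2)[OF assms(2)]
    by eventually_elim simp
qed

lemma powr_add_le_weighted:
  fixes a b A B p :: real
  assumes "p \<ge> 1" "a \<ge> 0" "b \<ge> 0" "A > 0" "B > 0"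
  shows "(a + b) powr p \<le> (A + B) powr p *
           (A / (A + B) * (a powr p / A powr p) + B / (A + B) * (b powr p / B powr p))"
proof -
  have edge: "x powr p \<le> (C + D) powr p * (C / (C + D) * (x powr p / C powr p))"
    if "x \<ge> 0" "C > 0" "D > 0" for x C D :: real
  proof -
    have "C powr (p - 1) \<le> (C + D) powr (p - 1)"
      using that assms(1) by (intro powr_mono2) auto
    hence "C powr p / C \<le> (C + D) powr p / (C + D)"
      using that by (simp add: powr_diff)
    hence "C powr p \<le> (C + D) powr p * (C / (C + D))"
      using that by (simp add: pos_divide_le_eq)
    hence "1 \<le> (C + D) powr p * (C / (C + D)) / C powr p"
      using that by (subst le_divide_eq_1_pos) auto
    hence "x powr p * 1 \<le> x powr p * ((C + D) powr p * (C / (C + D)) / C powr p)"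
      by (intro mult_left_mono) auto
    thus ?thesis by (simp add: mult_ac)
  qed
  show ?thesis
  proof (cases "a = 0 \<or> b = 0")
    case True
    thus ?thesis
      using edge[of b B A] edge[of a A B] assms by (auto simp: add.commute)
  next
    case False
    hence pos: "a / A > 0" "b / B > 0" using assms by auto
    have w: "A / (A + B) = 1 - B / (A + B)" using assms by (simp add: field_simps)
    have "((1 - B / (A + B)) *\<^sub>R (a / A) + (B / (A + B)) *\<^sub>R (b / B)) powr p
        \<le> (1 - B / (A + B)) * (a / A) powr p + B / (A + B) * (b / B) powr p"
      using powr_convex[OF assms(1)] pos assms by (intro convex_onD) auto
    also have "(1 - B / (A + B)) *\<^sub>R (a / A) + (B / (A + B)) *\<^sub>R (b / B) = (a + b) / (A + B)"
      unfolding w[symmetric] using assms by (simp add: add_divide_distrib)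
    finally have "(a + b) powr p / (A + B) powr p
        \<le> A / (A + B) * (a powr p / A powr p) + B / (A + B) * (b powr p / B powr p)"
      using assms by (simp add: w[symmetric] powr_divide)
    thus ?thesis
      using assms by (simp add: pos_divide_le_eq mult.commute)
  qed
qed

lemma Lp_fun_add:
  assumes "p \<ge> 1" "f \<in> Lp_fun p M" "g \<in> Lp_fun p M"
  shows "(\<lambda>x. f x + g x) \<in> Lp_fun p M"
proof -
  have [measurable]: "f \<in> borel_measurable M" "g \<in> borel_measurable M"
    and int: "integrable M (\<lambda>x. \<bar>f x\<bar> powr p)" "integrable M (\<lambda>x. \<bar>g x\<bar> powr p)"
    using assms by (auto simp: Lp_fun_def)
  have "integrable M (\<lambda>x. \<bar>f x + g x\<bar> powr p)"
  proof (rule Bochner_Integration.integrable_bound)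
    show "integrable M (\<lambda>x. 2 powr p * (1/2 * \<bar>f x\<bar> powr p + 1/2 * \<bar>g x\<bar> powr p))"
      using int by (intro integrable_mult_right Bochner_Integration.integrable_add)
    show "AE x in M. norm (\<bar>f x + g x\<bar> powr p)
            \<le> norm (2 powr p * (1/2 * \<bar>f x\<bar> powr p + 1/2 * \<bar>g x\<bar> powr p))"
    proof (rule AE_I2)
      fix x
      have "\<bar>f x + g x\<bar> powr p \<le> (\<bar>f x\<bar> + \<bar>g x\<bar>) powr p"
        using assms(1) by (intro powr_mono2) auto
      also have "\<dots> \<le> 2 powr p * (1/2 * \<bar>f x\<bar> powr p + 1/2 * \<bar>g x\<bar> powr p)"
        using powr_add_le_weighted[of p "\<bar>f x\<bar>" "\<bar>g x\<bar>" 1 1] assms(1) by simp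
      finally show "norm (\<bar>f x + g x\<bar> powr p)
            \<le> norm (2 powr p * (1/2 * \<bar>f x\<bar> powr p + 1/2 * \<bar>g x\<bar> powr p))"
        by simp
    qed
  qed measurable
  thus ?thesis by (simp add: Lp_fun_def)
qed

lemma Lp_fun_diff:
  assumes "p \<ge> 1" "f \<in> Lp_fun p M" "g \<in> Lp_fun p M"
  shows "(\<lambda>x. f x - g x) \<in> Lp_fun p M"
proof -
  have "(\<lambda>x. - g x) \<in> Lp_fun p M" using assms(3) by (simp add: Lp_fun_def)
  from Lp_fun_add[OF assms(1,2) this] show ?thesis by simp
qed

lemma Lp_norm_powr:
  assumes "p \<ge> 1"
  shows "Lp_norm p M f powr p = (\<integral>x. \<bar>f x\<bar> powr p \<partial>M)"
proof -
  have "(\<integral>x. \<bar>f x\<bar> powr p \<partial>M) \<ge> 0" by (intro integral_nonneg_AE) auto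
  thus ?thesis using assms by (simp add: Lp_norm_def powr_powr)
qed

lemma Lp_norm_eq_0_iff:
  assumes "p \<ge> 1" "f \<in> Lp_fun p M"
  shows "Lp_norm p M f = 0 \<longleftrightarrow> (AE x in M. f x = 0)"
proof -
  have "Lp_norm p M f = 0 \<longleftrightarrow> (\<integral>x. \<bar>f x\<bar> powr p \<partial>M) = 0"
    by (simp add: Lp_norm_def)
  also have "\<dots> \<longleftrightarrow> (AE x in M. \<bar>f x\<bar> powr p = 0)"
    using assms(2) by (intro integral_nonneg_eq_0_iff_AE) (auto simp: Lp_fun_def)
  finally show ?thesis by simp
qed

lemma Minkowski:
  assumes p: "p \<ge> 1" and f: "f \<in> Lp_fun p M" and g: "g \<in> Lp_fun p M"
  shows "Lp_norm p M (\<lambda>x. f x + g x) \<le> Lp_norm p M f + Lp_norm p M g"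
proof -
  define A B where "A = Lp_norm p M f" and "B = Lp_norm p M g"
  have nn: "A \<ge> 0" "B \<ge> 0" by (auto simp: A_def B_def Lp_norm_def)
  have [measurable]: "f \<in> borel_measurable M" "g \<in> borel_measurable M"
    and int: "integrable M (\<lambda>x. \<bar>f x\<bar> powr p)" "integrable M (\<lambda>x. \<bar>g x\<bar> powr p)"
    using f g by (auto simp: Lp_fun_def)
  have sum: "integrable M (\<lambda>x. \<bar>f x + g x\<bar> powr p)"
    using Lp_fun_add[OF p f g] by (auto simp: Lp_fun_def)
  consider "A = 0" | "B = 0" | "A > 0" "B > 0" using nn by linarith
  thus ?thesis
  proof cases
    case 1
    hence "AE x in M. f x = 0" using Lp_norm_eq_0_iff[OF p f] by (simp add: A_def)
    hence "AE x in M. f x + g x = g x" by eventually_elim simp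
    hence "Lp_norm p M (\<lambda>x. f x + g x) = B"
      unfolding B_def by (intro Lp_norm_cong_AE) auto
    thus ?thesis using nn by (simp add: A_def B_def)
  next
    case 2
    hence "AE x in M. g x = 0" using Lp_norm_eq_0_iff[OF p g] by (simp add: B_def)
    hence "AE x in M. f x + g x = f x" by eventually_elim simp
    hence "Lp_norm p M (\<lambda>x. f x + g x) = A"
      unfolding A_def by (intro Lp_norm_cong_AE) auto
    thus ?thesis using nn by (simp add: A_def B_def)
  next
    case 3
    let ?R = "\<lambda>x. (A + B) powr p *
        (A / (A + B) * (\<bar>f x\<bar> powr p / A powr p) + B / (A + B) * (\<bar>g x\<bar> powr p / B powr p))"
    have "(\<integral>x. \<bar>f x + g x\<bar> powr p \<partial>M) \<le> (\<integral>x. ?R x \<partial>M)"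
    proof (rule integral_mono[OF sum])
      show "integrable M ?R"
        using int by (intro integrable_mult_right Bochner_Integration.integrable_add
            integrable_divide)
      fix x
      have "\<bar>f x + g x\<bar> powr p \<le> (\<bar>f x\<bar> + \<bar>g x\<bar>) powr p"
        using p by (intro powr_mono2) auto
      also have "\<dots> \<le> ?R x"
        using p 3 by (intro powr_add_le_weighted) auto
      finally show "\<bar>f x + g x\<bar> powr p \<le> ?R x" .
    qed
    also have "(\<integral>x. ?R x \<partial>M) = (A + B) powr p *
        (A / (A + B) * ((\<integral>x. \<bar>f x\<bar> powr p \<partial>M) / A powr p)
          + B / (A + B) * ((\<integral>x. \<bar>g x\<bar> powr p \<partial>M) / B powr p))"
      using int by (simp add: Bochner_Integration.integral_add)
    also have "\<dots> = (A + B) powr p * (A / (A + B) + B / (A + B))"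
      using 3 by (simp add: Lp_norm_powr[OF p, symmetric] A_def[symmetric] B_def[symmetric])
    also have "\<dots> = (A + B) powr p"
      using 3 by (simp add: add_divide_distrib[symmetric])
    finally have "Lp_norm p M (\<lambda>x. f x + g x) \<le> ((A + B) powr p) powr (1 / p)"
      unfolding Lp_norm_def using p
      by (intro powr_mono2) (auto intro!: integral_nonneg_AE)
    also have "\<dots> = A + B" using p 3 by (simp add: powr_powr)
    finally show ?thesis by (simp add: A_def B_def)
  qed
qed

lemma Metric_space_Lp:
  assumes p: "p \<ge> 1"
  shows "Metric_space (Lp_space p M) (Lp_dist p M)"
proof
  fix F G
  show "0 \<le> Lp_dist p M F G" by (simp add: Lp_dist_def Lp_norm_def)
  show "Lp_dist p M F G = Lp_dist p M G F"
    by (simp add: Lp_dist_def Lp_norm_def abs_minus_commute)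
next
  fix F G assume "F \<in> Lp_space p M" "G \<in> Lp_space p M"
  then obtain f g where fg: "f \<in> Lp_fun p M" "g \<in> Lp_fun p M"
    and F: "F = Lp_class p M f" and G: "G = Lp_class p M g"
    by (metis Lp_space_cases)
  show "Lp_dist p M F G = 0 \<longleftrightarrow> F = G"
    using Lp_norm_eq_0_iff[OF p Lp_fun_diff[OF p fg]]
    by (simp add: F G Lp_dist_class[OF fg] Lp_class_eq_iff[OF fg])
next
  fix F G H assume "F \<in> Lp_space p M" "G \<in> Lp_space p M" "H \<in> Lp_space p M"
  then obtain f g h where f: "f \<in> Lp_fun p M" and g: "g \<in> Lp_fun p M" and h: "h \<in> Lp_fun p M"
    and FGH: "F = Lp_class p M f" "G = Lp_class p M g" "H = Lp_class p M h"
    by (metis Lp_space_cases)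
  show "Lp_dist p M F H \<le> Lp_dist p M F G + Lp_dist p M G H"
    using Minkowski[OF p Lp_fun_diff[OF p f g] Lp_fun_diff[OF p g h]]
    by (simp add: FGH Lp_dist_class f g h)
qed

section \<open>Shallow networks\<close>

definition ReLU :: "real \<Rightarrow> real" where
  "ReLU x = (if x > 0 then x else 0)"

definition ELU :: "real \<Rightarrow> real \<Rightarrow> real" where
  "ELU \<alpha> x = (if x > 0 then x else \<alpha> * (exp x - 1))"

definition Softplus :: "real \<Rightarrow> real" where
  "Softplus x = ln (exp x + 1)"

definition LeakyReLU :: "real \<Rightarrow> real \<Rightarrow> real" where
  "LeakyReLU \<alpha> x = (if x > 0 then x else \<alpha> * x)"

definition shallow_nets :: "(real \<Rightarrow> real) \<Rightarrow> ((real ^ 'm) \<Rightarrow> real) set" where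
  "shallow_nets \<phi> = {\<lambda>x. \<Sum>i<k. t i * \<phi> (y i \<bullet> x + \<rho> i) |
     (k :: nat) (t :: nat \<Rightarrow> real) (y :: nat \<Rightarrow> real ^ 'm) (\<rho> :: nat \<Rightarrow> real). True}"

text \<open>
  \<open>\<real> \<times> [0,1]\<^sup>n\<close> inside \<open>\<real>\<^sup>n\<^sup>+\<^sup>1\<close> with \<open>n + 1 = CARD('m)\<close>. The index type \<open>'m\<close> carries no
  order, so the unbounded coordinate \<open>j\<^sub>0\<close> is an explicit parameter; this rendering
  includes \<open>n = 0\<close>.
\<close>

definition strip :: "'m \<Rightarrow> (real ^ 'm) set" where
  "strip j\<^sub>0 = {x. \<forall>j. j \<noteq> j\<^sub>0 \<longrightarrow> x $ j \<in> {0..1}}"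

end

theory Submission
  imports Defs
begin

text \<open>
  Write \<open>t = y \<bullet> x\<close> for a ridge vector \<open>y\<close> with \<open>y\<^sub>j\<^sub>0 = 1\<close>. The increment \<open>\<phi>(s + 1) - \<phi>(s)\<close> is,
  up to an error \<open>O(1 / (1 + \<bar>s\<bar>))\<close>, a step function with a nonzero jump, so rescaled differences of
  two increments tend to ridge indicators \<open>1\<^sub>[\<^sub>a\<^sub>,\<^sub>b\<^sub>)(t)\<close>. All limits are dominated by a multiple of
  \<open>1 / (1 + \<bar>x\<^sub>j\<^sub>0\<bar>)\<close>, whose \<open>p\<close>-th power is integrable over the strip. Differentiating
  ridge functions with respect to \<open>y\<^sub>j\<close> multiplies them by the bounded coordinate \<open>x\<^sub>j\<close>, at the price of
  replacing the profile by its derivative; since \<open>p > 1\<close>, derivatives of compactly supported profiles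
  are still dense. Hence the closure contains all products of a polynomial in the bounded coordinates
  and an indicator of an interval in \<open>x\<^sub>j\<^sub>0\<close>, and Stone--Weierstrass finishes the proof.
\<close>

section \<open>Closures in \<open>L\<^sup>p\<close>\<close>

text \<open>The closure is taken among functions rather than classes, so that pointwise limits can
  be used directly. The approximants themselves must be \<open>p\<close>-integrable, since a single
  network in general is not.\<close>

definition Lp_closure :: "real \<Rightarrow> 'a measure \<Rightarrow> ('a \<Rightarrow> real) set \<Rightarrow> ('a \<Rightarrow> real) set" where
  "Lp_closure p M A =
     {f \<in> Lp_fun p M. \<forall>e>0. \<exists>s \<in> A \<inter> Lp_fun p M. Lp_norm p M (\<lambda>x. f x - s x) < e}"

lemma Lp_fun_scale: "f \<in> Lp_fun p M \<Longrightarrow> (\<lambda>x. c * f x) \<in> Lp_fun p M"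
  by (auto simp: Lp_fun_def abs_mult powr_mult)

lemma Lp_norm_scale: "p \<ge> 1 \<Longrightarrow> Lp_norm p M (\<lambda>x. c * f x) = \<bar>c\<bar> * Lp_norm p M f"
  by (simp add: Lp_norm_def abs_mult powr_mult powr_powr integral_nonneg_AE)

lemma Lp_closure_subset: "f \<in> A \<Longrightarrow> f \<in> Lp_fun p M \<Longrightarrow> f \<in> Lp_closure p M A"
  by (auto simp: Lp_closure_def Lp_norm_def intro!: bexI[of _ f])

lemma Lp_closure_add:
  assumes p: "p \<ge> 1"
    and A: "\<And>f g. f \<in> A \<Longrightarrow> g \<in> A \<Longrightarrow> (\<lambda>x. f x + g x) \<in> A"
    and fg: "f \<in> Lp_closure p M A" "g \<in> Lp_closure p M A"
  shows "(\<lambda>x. f x + g x) \<in> Lp_closure p M A"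
proof -
  have L: "f \<in> Lp_fun p M" "g \<in> Lp_fun p M" using fg by (auto simp: Lp_closure_def)
  have "\<exists>s \<in> A \<inter> Lp_fun p M. Lp_norm p M (\<lambda>x. f x + g x - s x) < e" if "e > 0" for e
  proof -
    obtain s where s: "s \<in> A" "s \<in> Lp_fun p M" "Lp_norm p M (\<lambda>x. f x - s x) < e/2"
      using fg(1) half_gt_zero[OF \<open>e > 0\<close>] unfolding Lp_closure_def by blast
    obtain t where t: "t \<in> A" "t \<in> Lp_fun p M" "Lp_norm p M (\<lambda>x. g x - t x) < e/2"
      using fg(2) half_gt_zero[OF \<open>e > 0\<close>] unfolding Lp_closure_def by blast
    have "Lp_norm p M (\<lambda>x. (f x - s x) + (g x - t x)) < e"
      using Minkowski[OF p Lp_fun_diff[OF p L(1) s(2)] Lp_fun_diff[OF p L(2) t(2)]] s t by simp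
    then show ?thesis
      using A[OF s(1) t(1)] Lp_fun_add[OF p s(2) t(2)]
      by (intro bexI[of _ "\<lambda>x. s x + t x"]) (auto simp: algebra_simps)
  qed
  then show ?thesis using Lp_fun_add[OF p L] by (auto simp: Lp_closure_def)
qed

lemma Lp_closure_scale:
  assumes p: "p \<ge> 1"
    and A: "\<And>f. f \<in> A \<Longrightarrow> (\<lambda>x. c * f x) \<in> A"
    and f: "f \<in> Lp_closure p M A"
  shows "(\<lambda>x. c * f x) \<in> Lp_closure p M A"
proof -
  have "\<exists>s \<in> A \<inter> Lp_fun p M. Lp_norm p M (\<lambda>x. c * f x - s x) < e" if "e > 0" for e
  proof -
    \<comment> \<open>The 1 in the denominator covers \<open>c = 0\<close>.\<close>
    obtain s where s: "s \<in> A" "s \<in> Lp_fun p M" "Lp_norm p M (\<lambda>x. f x - s x) < e / (\<bar>c\<bar> + 1)"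
      using f \<open>e > 0\<close> unfolding Lp_closure_def by (fastforce dest: spec[of _ "e / (\<bar>c\<bar> + 1)"])
    have "0 \<le> Lp_norm p M (\<lambda>x. f x - s x)" by (simp add: Lp_norm_def)
    then have "\<bar>c\<bar> * Lp_norm p M (\<lambda>x. f x - s x) \<le> (\<bar>c\<bar> + 1) * Lp_norm p M (\<lambda>x. f x - s x)"
      by (intro mult_right_mono) auto
    also have "\<dots> < e" using s(3) by (simp add: field_simps)
    finally have "Lp_norm p M (\<lambda>x. c * (f x - s x)) < e"
      by (simp add: Lp_norm_scale[OF p])
    then show ?thesis
      using A[OF s(1)] Lp_fun_scale[OF s(2)]
      by (intro bexI[of _ "\<lambda>x. c * s x"]) (auto simp: algebra_simps)
  qed
  then show ?thesis using f Lp_fun_scale by (auto simp: Lp_closure_def)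
qed

text \<open>All limit passages below go through this lemma. The bound by \<open>G\<close> survives
  in the limit, so dominated convergence applies to \<open>\<bar>f x - F n x\<bar> powr p\<close>
  with majorant \<open>\<bar>2 * G x\<bar> powr p\<close>. As \<open>F n\<close> lies only in the
  closure, a second approximation by an element of \<open>A\<close> costs the other half of
  \<open>e\<close>.\<close>

lemma Lp_closure_dominated:
  assumes p: "p \<ge> 1" and F: "\<And>n. F n \<in> Lp_closure p M A"
    and G: "G \<in> Lp_fun p M" and dom: "\<And>n x. x \<in> space M \<Longrightarrow> \<bar>F n x\<bar> \<le> G x"
    and f: "f \<in> borel_measurable M" and lim: "AE x in M. (\<lambda>n. F n x) \<longlonglongrightarrow> f x"
  shows "f \<in> Lp_closure p M A"
proof -
  have [measurable]: "F n \<in> borel_measurable M" "G \<in> borel_measurable M" "f \<in> borel_measurable M" for n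
    using F G f by (auto simp: Lp_closure_def Lp_fun_def)
  have bound: "AE x in M. \<bar>f x\<bar> \<le> G x"
    using lim AE_space
  proof eventually_elim
    case (elim x)
    then show ?case
      by (intro tendsto_upperbound[OF tendsto_rabs[OF elim(1)]] always_eventually) (auto intro: dom)
  qed
  have int: "integrable M (\<lambda>x. \<bar>f x\<bar> powr p)"
  proof (rule Bochner_Integration.integrable_bound)
    show "integrable M (\<lambda>x. \<bar>G x\<bar> powr p)" using G by (simp add: Lp_fun_def)
    show "AE x in M. norm (\<bar>f x\<bar> powr p) \<le> norm (\<bar>G x\<bar> powr p)"
      using bound by eventually_elim (use p in \<open>auto intro!: powr_mono2\<close>)
  qed measurable
  have Lf: "f \<in> Lp_fun p M" using int by (simp add: Lp_fun_def)
  have LF: "F n \<in> Lp_fun p M" for n using F by (auto simp: Lp_closure_def)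
  have "(\<lambda>n. \<integral>x. \<bar>f x - F n x\<bar> powr p \<partial>M) \<longlonglongrightarrow> (\<integral>x. 0 \<partial>M)"
  proof (rule integral_dominated_convergence)
    show "integrable M (\<lambda>x. \<bar>2 * G x\<bar> powr p)"
      using Lp_fun_scale[OF G, of 2] by (simp add: Lp_fun_def)
    show "AE x in M. (\<lambda>n. \<bar>f x - F n x\<bar> powr p) \<longlonglongrightarrow> 0"
      using lim
    proof eventually_elim
      case (elim x)
      have "(\<lambda>n. \<bar>f x - F n x\<bar>) \<longlonglongrightarrow> \<bar>f x - f x\<bar>" by (intro tendsto_intros elim)
      then show ?case using p by (intro tendsto_zero_powrI) auto
    qed
    fix n
    show "AE x in M. norm (\<bar>f x - F n x\<bar> powr p) \<le> \<bar>2 * G x\<bar> powr p"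
      using bound AE_space
    proof eventually_elim
      case (elim x)
      then show ?case using p dom[of x n] by (auto intro!: powr_mono2)
    qed
  qed measurable
  then have "(\<lambda>n. Lp_norm p M (\<lambda>x. f x - F n x)) \<longlonglongrightarrow> 0"
    unfolding Lp_norm_def using p
    by (intro tendsto_zero_powrI) (auto intro!: always_eventually integral_nonneg_AE)
  then have conv: "\<exists>n. Lp_norm p M (\<lambda>x. f x - F n x) < e" if "e > 0" for e
    using order_tendstoD(2)[OF _ that] by (fastforce dest: eventually_happens)
  have "\<exists>s \<in> A \<inter> Lp_fun p M. Lp_norm p M (\<lambda>x. f x - s x) < e" if "e > 0" for e
  proof -
    obtain n where n: "Lp_norm p M (\<lambda>x. f x - F n x) < e/2"
      using conv[OF half_gt_zero[OF \<open>e > 0\<close>]] by blast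
    obtain s where s: "s \<in> A" "s \<in> Lp_fun p M" "Lp_norm p M (\<lambda>x. F n x - s x) < e/2"
      using F[of n] half_gt_zero[OF \<open>e > 0\<close>] unfolding Lp_closure_def by blast
    have "Lp_norm p M (\<lambda>x. (f x - F n x) + (F n x - s x)) < e"
      using Minkowski[OF p Lp_fun_diff[OF p Lf LF[of n]] Lp_fun_diff[OF p LF[of n] s(2)]] s n
      by simp
    then show ?thesis using s by auto
  qed
  then show ?thesis using Lf by (auto simp: Lp_closure_def)
qed

text \<open>Passage from functions to classes: by \<open>Lp_dist_class\<close>, membership in a ball
  can be tested on arbitrary representatives.\<close>

lemma closure_of_eq_Lp_space:
  assumes p: "p \<ge> 1" and dense: "Lp_fun p M \<subseteq> Lp_closure p M A"
  shows "Lp_topology p M closure_of (Lp_class p M ` (A \<inter> Lp_fun p M)) = Lp_space p M"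
proof -
  interpret Metric_space "Lp_space p M" "Lp_dist p M" by (rule Metric_space_Lp[OF p])
  have "\<exists>S \<in> Lp_class p M ` (A \<inter> Lp_fun p M). S \<in> mball F r"
    if "F \<in> Lp_space p M" and "r > 0" for F r
  proof -
    obtain f where f: "f \<in> Lp_fun p M" "F = Lp_class p M f"
      using \<open>F \<in> Lp_space p M\<close> by (rule Lp_space_cases)
    obtain s where s: "s \<in> A" "s \<in> Lp_fun p M" "Lp_norm p M (\<lambda>x. f x - s x) < r"
      using dense f(1) \<open>r > 0\<close> unfolding Lp_closure_def by blast
    then have "Lp_class p M s \<in> mball F r"
      using f by (simp add: in_mball Lp_class_in_space Lp_dist_class)
    then show ?thesis using s by auto
  qed
  then show ?thesis by (auto simp: metric_closure_of)
qed

section \<open>Shallow networks\<close>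

lemma shallow_nets_unit: "(\<lambda>x. c * \<phi> (y \<bullet> x + d)) \<in> shallow_nets \<phi>"
  unfolding shallow_nets_def
  by (rule CollectI, rule exI[of _ 1], rule exI[of _ "\<lambda>_. c"], rule exI[of _ "\<lambda>_. y"],
      rule exI[of _ "\<lambda>_. d"]) simp

lemma shallow_nets_add:
  fixes f g :: "real ^ 'm \<Rightarrow> real"
  assumes "f \<in> shallow_nets \<phi>" "g \<in> shallow_nets \<phi>"
  shows "(\<lambda>x. f x + g x) \<in> shallow_nets \<phi>"
proof -
  obtain k t and y :: "nat \<Rightarrow> real ^ 'm" and \<rho> where f: "f = (\<lambda>x. \<Sum>i<k. t i * \<phi> (y i \<bullet> x + \<rho> i))"
    using assms(1) unfolding shallow_nets_def by blast
  obtain k' t' and y' :: "nat \<Rightarrow> real ^ 'm" and \<rho>' where g: "g = (\<lambda>x. \<Sum>i<k'. t' i * \<phi> (y' i \<bullet> x + \<rho>' i))"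
    using assms(2) unfolding shallow_nets_def by blast
  \<comment> \<open>Concatenation of two parameter lists, the second one shifted by
    \<open>k\<close>.\<close>
  let ?c = "\<lambda>a b i. if i < k then a i else b (i - k)"
  have "(\<Sum>i<k + k'. ?c t t' i * \<phi> (?c y y' i \<bullet> x + ?c \<rho> \<rho>' i))
      = (\<Sum>i<k. t i * \<phi> (y i \<bullet> x + \<rho> i)) + (\<Sum>i<k'. t' i * \<phi> (y' i \<bullet> x + \<rho>' i))" for x
    by (induction k') auto
  then have "(\<lambda>x. f x + g x) = (\<lambda>x. \<Sum>i<k + k'. ?c t t' i * \<phi> (?c y y' i \<bullet> x + ?c \<rho> \<rho>' i))"
    by (simp add: f g)
  then show ?thesis unfolding shallow_nets_def by (intro CollectI exI conjI TrueI)
qed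

lemma shallow_nets_scale:
  fixes f :: "real ^ 'm \<Rightarrow> real"
  assumes "f \<in> shallow_nets \<phi>"
  shows "(\<lambda>x. c * f x) \<in> shallow_nets \<phi>"
proof -
  obtain k t and y :: "nat \<Rightarrow> real ^ 'm" and \<rho> where "f = (\<lambda>x. \<Sum>i<k. t i * \<phi> (y i \<bullet> x + \<rho> i))"
    using assms unfolding shallow_nets_def by blast
  then have "(\<lambda>x. c * f x) = (\<lambda>x. \<Sum>i<k. (c * t i) * \<phi> (y i \<bullet> x + \<rho> i))"
    by (simp add: sum_distrib_left mult.assoc)
  then show ?thesis unfolding shallow_nets_def by (intro CollectI exI conjI TrueI)
qed

section \<open>The strip\<close>

lemma closed_strip: "closed (strip j0)"
proof -
  have "strip j0 = (\<Inter>j \<in> -{j0}. {x. 0 \<le> x $ j} \<inter> {x. x $ j \<le> 1})"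
    by (auto simp: strip_def)
  moreover have "closed \<dots>"
    by (intro closed_INT ballI closed_Int closed_Collect_le continuous_intros)
  ultimately show ?thesis by simp
qed

lemma strip_lebesgue [measurable]: "strip j0 \<in> sets lebesgue"
  by (intro sets_completionI_sets) (simp add: borel_closed closed_strip)

lemma nn_integral_inverse_1_plus_square:
  "(\<integral>\<^sup>+x. ennreal (1 / (1 + x\<^sup>2)) \<partial>lborel) < \<infinity>"
proof -
  let ?f = "\<lambda>x::real. 1 / (1 + x\<^sup>2)"
  let ?h = "\<lambda>x. ennreal (?f x) * indicator {0..} x"
  have half: "(\<integral>\<^sup>+x. ?h x \<partial>lborel) = ennreal (pi / 2 - arctan 0)"
  proof (rule nn_integral_FTC_atLeast)
    show "(arctan \<longlongrightarrow> pi / 2) at_top" by (rule tendsto_arctan_at_top)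
    show "(arctan has_real_derivative ?f x) (at x)" for x
      by (auto intro!: derivative_eq_intros simp: field_simps)
  qed auto
  \<comment> \<open>Only an inequality, because the two half-lines overlap at 0.\<close>
  have "(\<integral>\<^sup>+x. ennreal (?f x) \<partial>lborel) \<le> (\<integral>\<^sup>+x. ?h x + ?h (-x) \<partial>lborel)"
    by (intro nn_integral_mono) (auto simp: indicator_def)
  also have "\<dots> = (\<integral>\<^sup>+x. ?h x \<partial>lborel) + (\<integral>\<^sup>+x. ?h (-x) \<partial>lborel)"
    by (intro nn_integral_add) auto
  also have "(\<integral>\<^sup>+x. ?h (-x) \<partial>lborel) = (\<integral>\<^sup>+x. ?h x \<partial>lborel)"
    using nn_integral_real_affine[of ?h "-1" 0] by simp
  finally show ?thesis unfolding half by (simp add: le_less_trans)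
qed

text \<open>The integrand times the indicator of the strip is a product of functions of one
  coordinate each, so Tonelli turns the integral into a finite product: an arctangent integral for
  \<open>j0\<close> and lengths of unit intervals for the other coordinates.\<close>

lemma strip_decay_integrable:
  "integrable (lebesgue_on (strip j0)) (\<lambda>x. 1 / (1 + (x $ j0)\<^sup>2))"
proof -
  define f :: "real ^ 'a \<Rightarrow> real \<Rightarrow> ennreal" where
    "f b s = (if b = axis j0 1 then ennreal (1 / (1 + s\<^sup>2)) else indicator {0..1} s)" for b s
  have eq: "ennreal (1 / (1 + (x $ j0)\<^sup>2)) * indicator (strip j0) x = (\<Prod>b\<in>Basis. f b (x \<bullet> b))" for x
  proof -
    have B: "Basis = range (\<lambda>j. axis j (1::real))" by (auto simp: Basis_vec_def)
    have "(\<Prod>b\<in>Basis. f b (x \<bullet> b)) = (\<Prod>j\<in>UNIV. f (axis j 1) (x $ j))"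
      unfolding B by (subst prod.reindex) (auto simp: inj_on_def axis_eq_axis inner_axis)
    also have "\<dots> = f (axis j0 1) (x $ j0) * (\<Prod>j\<in>UNIV - {j0}. f (axis j 1) (x $ j))"
      by (rule prod.remove) auto
    also have "(\<Prod>j\<in>UNIV - {j0}. f (axis j 1) (x $ j))
        = (\<Prod>j\<in>UNIV - {j0}. indicator {0..1} (x $ j))"
      by (intro prod.cong) (auto simp: f_def axis_eq_axis)
    also have "\<dots> = indicator (strip j0) x"
    proof (cases "x \<in> strip j0")
      case True
      then show ?thesis by (auto simp: strip_def intro!: prod.neutral)
    next
      case False
      then obtain j where "j \<noteq> j0" "x $ j \<notin> {0..1}" by (auto simp: strip_def)
      then have "(\<Prod>j\<in>UNIV - {j0}. indicator {0..1} (x $ j) :: ennreal) = 0"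
        by (intro prod_zero) (auto intro!: bexI[of _ j])
      then show ?thesis using False by simp
    qed
    finally show ?thesis by (simp add: f_def)
  qed
  have fin: "(\<integral>\<^sup>+s. f b s \<partial>lborel) < \<infinity>" for b
    using nn_integral_inverse_1_plus_square by (cases "b = axis j0 1") (auto simp: f_def)
  have "(\<integral>\<^sup>+x. ennreal (1 / (1 + (x $ j0)\<^sup>2)) \<partial>(lebesgue_on (strip j0)))
      = (\<integral>\<^sup>+x. ennreal (1 / (1 + (x $ j0)\<^sup>2)) * indicator (strip j0) x \<partial>lebesgue)"
    by (subst nn_integral_restrict_space) auto
  also have "\<dots> = (\<integral>\<^sup>+x. (\<Prod>b\<in>Basis. f b (x \<bullet> b)) \<partial>lborel)"
    unfolding eq by (subst nn_integral_completion) auto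
  also have "\<dots> = (\<Prod>b\<in>Basis. (\<integral>\<^sup>+s. f b s \<partial>lborel))"
    by (intro nn_integral_lborel_prod) (auto simp: f_def)
  also have "\<dots> < \<infinity>"
    using finite_Basis by (induction rule: finite_induct) (use fin in \<open>auto simp: ennreal_mult_less_top\<close>)
  finally have "(\<integral>\<^sup>+x. ennreal (1 / (1 + (x $ j0)\<^sup>2)) \<partial>(lebesgue_on (strip j0))) < \<infinity>" .
  moreover have "continuous_on UNIV (\<lambda>x::real^'a. 1 / (1 + (x $ j0)\<^sup>2))"
    by (intro continuous_intros) (auto simp: add_nonneg_eq_0_iff)
  then have "(\<lambda>x::real^'a. 1 / (1 + (x $ j0)\<^sup>2)) \<in> borel_measurable (lebesgue_on (strip j0))"
    by (intro measurable_restrict_space1 measurable_completion)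
       (auto intro: borel_measurable_continuous_onI)
  ultimately show ?thesis by (intro integrableI_nonneg) auto
qed

text \<open>The base \<open>1 / (1 + \<bar>t\<bar>)\<close> is at most 1, so
  \<open>2 \<le> p\<close> reduces the claim to the exponent 2.\<close>

lemma strip_decay_Lp:
  assumes "2 \<le> p"
  shows "(\<lambda>x. C / (1 + \<bar>x $ j0\<bar>)) \<in> Lp_fun p (lebesgue_on (strip j0))"
proof -
  have "continuous_on UNIV (\<lambda>x::real^'a. 1 / (1 + \<bar>x $ j0\<bar>))"
    by (intro continuous_intros) auto
  then have [measurable]: "(\<lambda>x::real^'a. 1 / (1 + \<bar>x $ j0\<bar>)) \<in> borel_measurable (lebesgue_on (strip j0))"
    by (intro measurable_restrict_space1 measurable_completion)
       (auto intro: borel_measurable_continuous_onI)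
  have le: "(1 / (1 + \<bar>t\<bar>)) powr p \<le> 1 / (1 + t\<^sup>2)" for t :: real
  proof -
    have "(1 / (1 + \<bar>t\<bar>)) powr p \<le> (1 / (1 + \<bar>t\<bar>)) powr 2"
      using assms by (intro powr_mono') auto
    also have "\<dots> = 1 / (1 + \<bar>t\<bar>)\<^sup>2" by (simp add: powr_numeral power_divide)
    also have "\<dots> \<le> 1 / (1 + t\<^sup>2)"
      by (intro divide_left_mono) (auto simp: power2_sum intro!: mult_pos_pos add_pos_nonneg)
    finally show ?thesis .
  qed
  have "integrable (lebesgue_on (strip j0)) (\<lambda>x. \<bar>1 / (1 + \<bar>x $ j0\<bar>)\<bar> powr p)"
    using strip_decay_integrable by (rule Bochner_Integration.integrable_bound) (use le in auto)
  then have "(\<lambda>x. 1 / (1 + \<bar>x $ j0\<bar>)) \<in> Lp_fun p (lebesgue_on (strip j0))"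
    by (simp add: Lp_fun_def)
  from Lp_fun_scale[OF this, of C] show ?thesis by simp
qed

lemma abs_coord_le_inner_strip:
  assumes "y $ j0 = 1" "x \<in> strip j0"
  shows "\<bar>x $ j0\<bar> \<le> \<bar>y \<bullet> x\<bar> + (\<Sum>j\<in>UNIV. \<bar>y $ j\<bar>)"
proof -
  have "y \<bullet> x = (\<Sum>j\<in>UNIV. y $ j * x $ j)" by (simp add: inner_vec_def)
  also have "\<dots> = x $ j0 + (\<Sum>j\<in>UNIV - {j0}. y $ j * x $ j)"
    using assms(1) by (subst sum.remove[of _ j0]) auto
  finally have "\<bar>x $ j0\<bar> \<le> \<bar>y \<bullet> x\<bar> + \<bar>\<Sum>j\<in>UNIV - {j0}. y $ j * x $ j\<bar>" by linarith
  also have "\<bar>\<Sum>j\<in>UNIV - {j0}. y $ j * x $ j\<bar> \<le> (\<Sum>j\<in>UNIV - {j0}. \<bar>y $ j * x $ j\<bar>)"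
    by (rule sum_abs)
  also have "\<dots> \<le> (\<Sum>j\<in>UNIV - {j0}. \<bar>y $ j\<bar>)"
    using assms(2) by (intro sum_mono) (auto simp: strip_def abs_mult intro!: mult_left_le)
  also have "\<dots> \<le> (\<Sum>j\<in>UNIV. \<bar>y $ j\<bar>)" by (intro sum_mono2) auto
  finally show ?thesis by simp
qed

text \<open>On the strip \<open>y \<bullet> x\<close> differs from \<open>x $ j0\<close> by a
  bounded amount. Majorants may therefore be stated in the ridge variable, where they are easy to
  check, and used in the coordinate \<open>j0\<close>, where they are known to be in
  \<open>L^p\<close>.\<close>

lemma decay_inner_le_decay_coord:
  assumes "y $ j0 = 1" "x \<in> strip j0" "0 \<le> C"
  shows "C / (1 + \<bar>y \<bullet> x\<bar>) \<le> C * (1 + (\<Sum>j\<in>UNIV. \<bar>y $ j\<bar>)) / (1 + \<bar>x $ j0\<bar>)"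
proof -
  let ?B = "\<Sum>j\<in>UNIV. \<bar>y $ j\<bar>"
  have B: "0 \<le> ?B" by (intro sum_nonneg) auto
  have "1 + \<bar>x $ j0\<bar> \<le> (1 + ?B) * (1 + \<bar>y \<bullet> x\<bar>)"
    using abs_coord_le_inner_strip[OF assms(1,2)] B by (auto simp: algebra_simps intro: order_trans)
  then have "C * (1 + \<bar>x $ j0\<bar>) \<le> C * ((1 + ?B) * (1 + \<bar>y \<bullet> x\<bar>))"
    using assms(3) by (rule mult_left_mono)
  then show ?thesis by (simp add: pos_divide_le_eq pos_le_divide_eq add_pos_nonneg mult_ac)
qed

text \<open>On the support \<open>1 + \<bar>t\<bar> \<le> 1 + R\<close>, so bounded functions of
  bounded support obey the required decay.\<close>

lemma supported_decay:
  fixes t v R C :: real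
  assumes "\<bar>v\<bar> \<le> C" "\<bar>t\<bar> > R \<Longrightarrow> v = 0" "0 \<le> R"
  shows "\<bar>v\<bar> \<le> C * (1 + R) / (1 + \<bar>t\<bar>)"
proof (cases "\<bar>t\<bar> > R")
  case True
  then show ?thesis using assms by (auto intro!: divide_nonneg_pos mult_nonneg_nonneg)
next
  case False
  have "\<bar>v\<bar> * (1 + \<bar>t\<bar>) \<le> C * (1 + R)"
    using False assms by (intro mult_mono) auto
  then show ?thesis by (simp add: pos_le_divide_eq add_pos_nonneg)
qed

section \<open>Ridge indicators\<close>

text \<open>The numbers \<open>l\<close> and \<open>r\<close> are the limits of the unit increments
  at minus and plus infinity. The error rate in \<open>increment\<close> is that of the majorants in
  \<open>strip_decay_Lp\<close>, and \<open>lr\<close> provides the jump.\<close>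

locale strip_network =
  fixes p :: real and j0 :: "'m :: finite" and \<phi> :: "real \<Rightarrow> real" and l r C :: real
  assumes p: "2 \<le> p"
    and measurable_activation [measurable]: "\<phi> \<in> borel_measurable borel"
    and increment: "\<bar>\<phi> (s + 1) - \<phi> s - (if 0 \<le> s then r else l)\<bar> \<le> C / (1 + \<bar>s\<bar>)"
    and lr: "l \<noteq> r"
begin

section \<open>The closure as a vector space stable under dominated limits\<close>

abbreviation V :: "(real ^ 'm \<Rightarrow> real) set" where
  "V \<equiv> Lp_closure p (lebesgue_on (strip j0)) (shallow_nets \<phi>)"

lemma V_add: "f \<in> V \<Longrightarrow> g \<in> V \<Longrightarrow> (\<lambda>x. f x + g x) \<in> V"
  using p by (intro Lp_closure_add shallow_nets_add) auto

lemma V_scale: "f \<in> V \<Longrightarrow> (\<lambda>x. c * f x) \<in> V"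
  using p by (intro Lp_closure_scale shallow_nets_scale) auto

lemma V_zero: "(\<lambda>x. 0) \<in> V"
proof -
  have "(\<lambda>x. 0 * \<phi> (0 \<bullet> x + 0)) \<in> shallow_nets \<phi>" by (rule shallow_nets_unit)
  then show ?thesis by (intro Lp_closure_subset) (auto simp: Lp_fun_def)
qed

lemma V_sum: "(\<And>i. i \<in> I \<Longrightarrow> f i \<in> V) \<Longrightarrow> (\<lambda>x. \<Sum>i\<in>I. f i x) \<in> V"
  by (induction I rule: infinite_finite_induct) (auto simp: V_zero intro: V_add)

lemma V_dominated:
  assumes F: "\<And>n. F n \<in> V"
    and dom: "\<And>n x. x \<in> strip j0 \<Longrightarrow> \<bar>F n x\<bar> \<le> K / (1 + \<bar>x $ j0\<bar>)"
    and lim: "\<And>x. x \<in> strip j0 \<Longrightarrow> (\<lambda>n. F n x) \<longlonglongrightarrow> f x"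
  shows "f \<in> V"
proof (rule Lp_closure_dominated[where F = F, OF _ F strip_decay_Lp[OF p, of K]])
  show "f \<in> borel_measurable (lebesgue_on (strip j0))"
  proof (rule borel_measurable_LIMSEQ_real)
    show "F n \<in> borel_measurable (lebesgue_on (strip j0))" for n
      using F by (auto simp: Lp_closure_def Lp_fun_def)
  qed (use lim in \<open>auto simp: space_restrict_space\<close>)
qed (use p dom lim in \<open>auto simp: space_restrict_space\<close>)

lemma V_dominated_ridge:
  assumes F: "\<And>n. F n \<in> V" and y: "y $ j0 = 1"
    and dom: "\<And>n x. x \<in> strip j0 \<Longrightarrow> \<bar>F n x\<bar> \<le> K / (1 + \<bar>y \<bullet> x\<bar>)"
    and lim: "\<And>x. x \<in> strip j0 \<Longrightarrow> (\<lambda>n. F n x) \<longlonglongrightarrow> f x"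
  shows "f \<in> V"
proof (rule V_dominated[OF F _ lim])
  fix n x assume x: "x \<in> strip j0"
  have "K / (1 + \<bar>y \<bullet> x\<bar>) \<le> \<bar>K\<bar> / (1 + \<bar>y \<bullet> x\<bar>)" by (intro divide_right_mono) auto
  then show "\<bar>F n x\<bar> \<le> \<bar>K\<bar> * (1 + (\<Sum>j\<in>UNIV. \<bar>y $ j\<bar>)) / (1 + \<bar>x $ j0\<bar>)"
    using dom[OF x, of n] decay_inner_le_decay_coord[OF y x, of "\<bar>K\<bar>"] by linarith
qed

lemma C_nonneg: "0 \<le> C"
  using increment[of 0] by simp

section \<open>Unit increments and their limiting step function\<close>

definition D :: "real \<Rightarrow> real" where "D s = \<phi> (s + 1) - \<phi> s"

definition J :: "real \<Rightarrow> real" where "J s = (if 0 \<le> s then r else l)"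

lemma D_J: "\<bar>D s - J s\<bar> \<le> C / (1 + \<bar>s\<bar>)"
  using increment[of s] by (simp add: D_def J_def)

text \<open>The shift by \<open>N\<close> makes the limit hold also at the jump \<open>t = a\<close>.\<close>

lemma D_tendsto_J: "(\<lambda>n. D ((real (Suc n))\<^sup>2 * (t - a) + real (Suc n))) \<longlonglongrightarrow> J (t - a)"
proof -
  let ?s = "\<lambda>n. (real (Suc n))\<^sup>2 * (t - a) + real (Suc n)"
  have ev: "\<forall>\<^sub>F n in sequentially. \<bar>?s n\<bar> \<ge> real (Suc n) \<and> J (?s n) = J (t - a)"
  proof (cases "t \<ge> a")
    case True
    then have "0 \<le> (real (Suc n))\<^sup>2 * (t - a)" for n by simp
    then show ?thesis
      using True by (intro always_eventually allI) (auto simp: J_def add_nonneg_nonneg)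
  next
    case False
    \<comment> \<open>With \<open>N = Suc n\<close> this choice gives
      \<open>N * (a - t) \<ge> 2\<close>, so the quadratic term is at most \<open>- 2 * N\<close>
      and the argument stays below \<open>- N\<close> despite the shift.\<close>
    obtain n0 where n0: "2 / (a - t) \<le> real n0" using real_arch_simple by blast
    show ?thesis
    proof (rule eventually_sequentiallyI[of n0])
      fix n assume "n0 \<le> n"
      with n0 have "2 / (a - t) \<le> real (Suc n)" by linarith
      then have "2 \<le> real (Suc n) * (a - t)" using False by (simp add: pos_divide_le_eq)
      then have "real (Suc n) * 2 \<le> real (Suc n) * (real (Suc n) * (a - t))"
        by (intro mult_left_mono) auto
      then have "?s n \<le> - real (Suc n)" by (simp add: power2_eq_square algebra_simps)
      then show "\<bar>?s n\<bar> \<ge> real (Suc n) \<and> J (?s n) = J (t - a)"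
        using False by (auto simp: J_def)
    qed
  qed
  have "(\<lambda>n. C / real (Suc n)) \<longlonglongrightarrow> 0"
    using LIMSEQ_Suc[OF lim_const_over_n[of C]] by simp
  moreover have "\<forall>\<^sub>F n in sequentially. norm (D (?s n) - J (t - a)) \<le> C / real (Suc n)"
    using ev
  proof eventually_elim
    case (elim n)
    then have "C / (1 + \<bar>?s n\<bar>) \<le> C / real (Suc n)"
      using C_nonneg by (intro divide_left_mono) auto
    then show ?case using D_J[of "?s n"] elim by auto
  qed
  ultimately have "(\<lambda>n. D (?s n) - J (t - a)) \<longlonglongrightarrow> 0"
    by (rule Lim_null_comparison[rotated])
  then show ?thesis by (rule LIM_zero_cancel)
qed

text \<open>The bound is uniform in \<open>n\<close>. With \<open>N = Suc n \<ge> 1\<close> the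
  argument factors as \<open>N * (N * (t - a) + 1)\<close>, so its modulus is at least
  \<open>\<bar>t - a\<bar> - 1\<close>.\<close>

lemma D_J_decay: "\<bar>D ((real (Suc n))\<^sup>2 * (t - a) + real (Suc n)) - J ((real (Suc n))\<^sup>2 * (t - a) + real (Suc n))\<bar>
    \<le> C * (2 + \<bar>a\<bar>) / (1 + \<bar>t\<bar>)"
proof -
  let ?N = "real (Suc n)"
  let ?s = "?N\<^sup>2 * (t - a) + ?N"
  have "\<bar>t - a\<bar> - 1 \<le> \<bar>N\<^sup>2 * (t - a) + N\<bar>" if "1 \<le> N" for N :: real
  proof -
    have "\<bar>z\<bar> - 1 \<le> \<bar>z + 1\<bar>" for z :: real by linarith
    moreover have "1 * \<bar>t - a\<bar> \<le> N * \<bar>t - a\<bar>" using that by (intro mult_right_mono) auto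
    ultimately have "\<bar>t - a\<bar> - 1 \<le> \<bar>N * (t - a) + 1\<bar>"
      using that by (metis (no_types) abs_mult abs_of_nonneg diff_right_mono mult_1 order_trans zero_le_one)
    also have "\<dots> \<le> N * \<bar>N * (t - a) + 1\<bar>"
      using mult_right_mono[OF that, of "\<bar>N * (t - a) + 1\<bar>"] by simp
    also have "\<dots> = \<bar>N * (N * (t - a) + 1)\<bar>" using that by (simp add: abs_mult)
    also have "N * (N * (t - a) + 1) = N\<^sup>2 * (t - a) + N"
      by (simp add: power2_eq_square algebra_simps)
    finally show ?thesis .
  qed
  from this[of ?N] have "\<bar>t - a\<bar> - 1 \<le> \<bar>?s\<bar>" by simp
  then have "1 + \<bar>t\<bar> \<le> (2 + \<bar>a\<bar>) + \<bar>?s\<bar>" by linarith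
  also have "\<dots> \<le> (2 + \<bar>a\<bar>) * (1 + \<bar>?s\<bar>)" by (simp add: algebra_simps)
  finally have "C * (1 + \<bar>t\<bar>) \<le> C * ((2 + \<bar>a\<bar>) * (1 + \<bar>?s\<bar>))"
    using C_nonneg by (rule mult_left_mono)
  then have "C / (1 + \<bar>?s\<bar>) \<le> C * (2 + \<bar>a\<bar>) / (1 + \<bar>t\<bar>)"
    by (simp add: pos_divide_le_eq pos_le_divide_eq add_pos_nonneg mult_ac)
  then show ?thesis using D_J[of ?s] by linarith
qed

text \<open>In the difference of two shifted increments the limits \<open>l\<close> and
  \<open>r\<close> cancel at both ends. What remains is a step difference of bounded support plus
  two decaying errors, hence a network in \<open>L^p\<close>; its limit is \<open>r - l\<close>
  times the indicator.\<close>

lemma ridge_indicator_in_V: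
  assumes y: "y $ j0 = 1" and ab: "a < b"
  shows "(\<lambda>x. indicator {a..<b} (y \<bullet> x)) \<in> V"
proof -
  let ?s = "\<lambda>n a t. (real (Suc n))\<^sup>2 * (t - a) + real (Suc n)"
  let ?F = "\<lambda>n x. D (?s n a (y \<bullet> x)) - D (?s n b (y \<bullet> x))"
  \<comment> \<open>The first two terms bound the errors from \<open>D_J_decay\<close>, the third
    the step difference. The radius exceeds \<open>\<bar>a\<bar> + \<bar>b\<bar>\<close> by 1
    because the shift by \<open>N\<close> moves each jump to the left by
    \<open>1 / N \<le> 1\<close>.\<close>
  define K where "K = C * (2 + \<bar>a\<bar>) + C * (2 + \<bar>b\<bar>) + \<bar>r - l\<bar> * (1 + (1 + \<bar>a\<bar> + \<bar>b\<bar>))"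
  have bound: "\<bar>D (?s n a t) - D (?s n b t)\<bar> \<le> K / (1 + \<bar>t\<bar>)" for n t
  proof -
    have "\<bar>J (?s n a t) - J (?s n b t)\<bar> \<le> \<bar>r - l\<bar> * (1 + (1 + \<bar>a\<bar> + \<bar>b\<bar>)) / (1 + \<bar>t\<bar>)"
    proof (rule supported_decay)
      assume t: "\<bar>t\<bar> > 1 + \<bar>a\<bar> + \<bar>b\<bar>"
      show "J (?s n a t) - J (?s n b t) = 0"
      proof (cases "t > 0")
        case True
        then have "0 \<le> (real (Suc n))\<^sup>2 * (t - a)" "0 \<le> (real (Suc n))\<^sup>2 * (t - b)" using t by auto
        then show ?thesis by (auto simp: J_def)
      next
        case False
        have "N\<^sup>2 * (t - c) + N < 0" if "t < c - 1" "1 \<le> N" for c N :: real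
        proof -
          have "N * 1 \<le> N * N" using that by (intro mult_left_mono) auto
          moreover have "N\<^sup>2 * (t - c) < N\<^sup>2 * (-1)"
            using that by (intro mult_strict_left_mono) auto
          ultimately show ?thesis by (simp add: power2_eq_square)
        qed
        then have "?s n a t < 0" "?s n b t < 0" using t False by auto
        then show ?thesis by (simp add: J_def)
      qed
    qed (auto simp: J_def)
    moreover have "\<bar>d - d'\<bar> \<le> u + v + w" if "\<bar>j - j'\<bar> \<le> w" "\<bar>d - j\<bar> \<le> u" "\<bar>d' - j'\<bar> \<le> v"
      for d d' j j' u v w :: real
      using that by linarith
    ultimately show ?thesis
      using D_J_decay[of n t a] D_J_decay[of n t b] unfolding K_def add_divide_distrib by blast
  qed
  have V: "?F n \<in> V" for n
  proof (rule Lp_closure_subset)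
    \<comment> \<open>The scaling is absorbed into the inner weights of the network, so each
      increment consists of two units with ridge vector \<open>?y\<close>.\<close>
    let ?M = "(real (Suc n))\<^sup>2" and ?y = "(real (Suc n))\<^sup>2 *\<^sub>R y"
    have arg: "?M * (y \<bullet> x - c) + real (Suc n) = ?y \<bullet> x + (real (Suc n) - ?M * c)" for x c
      by (simp add: algebra_simps)
    have "(\<lambda>x. (1 * \<phi> (?y \<bullet> x + (real (Suc n) - ?M * a + 1)) + (-1) * \<phi> (?y \<bullet> x + (real (Suc n) - ?M * a)))
             + ((-1) * \<phi> (?y \<bullet> x + (real (Suc n) - ?M * b + 1)) + 1 * \<phi> (?y \<bullet> x + (real (Suc n) - ?M * b))))
        \<in> shallow_nets \<phi>"
      by (intro shallow_nets_add shallow_nets_unit)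
    then show net: "?F n \<in> shallow_nets \<phi>"
      unfolding arg D_def by (simp add: algebra_simps)
    have cont: "continuous_on UNIV (\<lambda>x::real^'m. y \<bullet> x)" by (intro continuous_intros)
    have [measurable]: "(\<lambda>x::real^'m. y \<bullet> x) \<in> borel_measurable (lebesgue_on (strip j0))"
      using borel_measurable_continuous_onI[OF cont]
      by (intro measurable_restrict_space1 measurable_completion) auto
    have [measurable]: "D \<in> borel_measurable borel" unfolding D_def by measurable
    have "integrable (lebesgue_on (strip j0)) (\<lambda>x. \<bar>?F n x\<bar> powr p)"
    proof (rule Bochner_Integration.integrable_bound)
      let ?K = "\<bar>K\<bar> * (1 + (\<Sum>j\<in>UNIV. \<bar>y $ j\<bar>))"
      show "integrable (lebesgue_on (strip j0)) (\<lambda>x. \<bar>?K / (1 + \<bar>x $ j0\<bar>)\<bar> powr p)"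
        using strip_decay_Lp[OF p, of ?K j0] by (simp add: Lp_fun_def)
      show "AE x in lebesgue_on (strip j0).
          norm (\<bar>?F n x\<bar> powr p) \<le> norm (\<bar>?K / (1 + \<bar>x $ j0\<bar>)\<bar> powr p)"
      proof (rule AE_I2)
        fix x assume "x \<in> space (lebesgue_on (strip j0))"
        then have x: "x \<in> strip j0" by (simp add: space_restrict_space)
        have "K / (1 + \<bar>y \<bullet> x\<bar>) \<le> \<bar>K\<bar> / (1 + \<bar>y \<bullet> x\<bar>)" by (intro divide_right_mono) auto
        then have "\<bar>?F n x\<bar> \<le> ?K / (1 + \<bar>x $ j0\<bar>)"
          using bound[of n "y \<bullet> x"] decay_inner_le_decay_coord[OF y x, of "\<bar>K\<bar>"] by linarith
        then have "\<bar>?F n x\<bar> powr p \<le> \<bar>?K / (1 + \<bar>x $ j0\<bar>)\<bar> powr p"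
          using p by (intro powr_mono2) auto
        then show "norm (\<bar>?F n x\<bar> powr p) \<le> norm (\<bar>?K / (1 + \<bar>x $ j0\<bar>)\<bar> powr p)" by simp
      qed
    qed measurable
    then show "?F n \<in> Lp_fun p (lebesgue_on (strip j0))" by (simp add: Lp_fun_def)
  qed
  have "(\<lambda>x. J (y \<bullet> x - a) - J (y \<bullet> x - b)) \<in> V"
    by (rule V_dominated_ridge[where F = ?F, OF V y bound]) (intro tendsto_diff D_tendsto_J)
  from V_scale[OF this, of "1 / (r - l)"]
  have "(\<lambda>x. 1 / (r - l) * (J (y \<bullet> x - a) - J (y \<bullet> x - b))) \<in> V" .
  moreover have "1 / (r - l) * (J (t - a) - J (t - b)) = indicator {a..<b} t" for t
    using lr ab by (auto simp: J_def indicator_def)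
  ultimately show ?thesis by simp
qed

end

section \<open>Ramps, the antiderivatives of interval indicators\<close>

definition ramp :: "real \<Rightarrow> real \<Rightarrow> real \<Rightarrow> real" where
  "ramp a b t = min (max (t - a) 0) (b - a)"

lemma ramp_mono_lipschitz:
  "0 \<le> h \<Longrightarrow> 0 \<le> ramp a b (t + h) - ramp a b t \<and> ramp a b (t + h) - ramp a b t \<le> h"
  by (auto simp: ramp_def min_def max_def)

text \<open>Since \<open>0 \<le> s\<close>, these are right-hand quotients, and the right derivative
  of the ramp is 1 at \<open>a\<close> and 0 at \<open>b\<close>; hence the half-open interval. At
  each \<open>t\<close> the quotient is eventually equal to its limit.\<close>

lemma difference_quotient_ramp:
  assumes s: "0 \<le> s" and ab: "a < b"
  shows "(\<lambda>k. real (Suc k) * (ramp a b (t + s / real (Suc k)) - ramp a b t))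
    \<longlonglongrightarrow> s * indicator {a..<b} t"
proof -
  have lim: "(\<lambda>k. t + s / real (Suc k)) \<longlonglongrightarrow> t"
    using tendsto_add[OF tendsto_const LIMSEQ_Suc[OF lim_const_over_n[of s]]] by simp
  have nn: "0 \<le> s / real (Suc k)" for k using s by simp
  consider "t < a" | "a \<le> t" "t < b" | "b \<le> t" by linarith
  then have "\<forall>\<^sub>F k in sequentially. real (Suc k) * (ramp a b (t + s / real (Suc k)) - ramp a b t)
      = s * indicator {a..<b} t"
  proof cases
    case 1
    from order_tendstoD(2)[OF lim this] show ?thesis
      by eventually_elim (use 1 in \<open>auto simp: ramp_def\<close>)
  next
    case 2
    from order_tendstoD(2)[OF lim 2(2)] show ?thesis
    proof eventually_elim
      case (elim k)
      have "ramp a b (t + s / real (Suc k)) - ramp a b t = s / real (Suc k)"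
        using 2 elim nn[of k] by (auto simp: ramp_def)
      then show ?case using 2 by simp
    qed
  next
    case 3
    have "ramp a b (t + s / real (Suc k)) = ramp a b t" for k
      using 3 ab nn[of k] by (auto simp: ramp_def)
    then show ?thesis using 3 by simp
  qed
  then show ?thesis by (rule tendsto_eventually)
qed

lemma clamp_tendsto:
  fixes f :: real
  assumes "g \<longlonglongrightarrow> f" "\<bar>f\<bar> \<le> c"
  shows "(\<lambda>n. max (- c) (min c (g n))) \<longlonglongrightarrow> f"
proof -
  have "(\<lambda>n. max (- c) (min c (g n))) \<longlonglongrightarrow> max (- c) (min c f)"
    by (intro tendsto_intros assms)
  also have "max (- c) (min c f) = f" using assms(2) by auto
  finally show ?thesis .
qed

text \<open>Projection to the bounded coordinates. It stays in \<open>real ^ 'm\<close>, so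
  functions of these coordinates need no second index type.\<close>

definition zero_coord :: "'m \<Rightarrow> real ^ 'm \<Rightarrow> real ^ 'm :: finite" where
  "zero_coord j0 x = (\<chi> j. if j = j0 then 0 else x $ j)"

section \<open>Profiles with coefficients in the bounded coordinates\<close>

context strip_network
begin

text \<open>In the limit a parameter \<open>s\<close> of \<open>h\<close> may be replaced by the ridge variable \<open>y \<bullet> x\<close>,
  which is rounded down to multiples of \<open>1/N\<close>.\<close>

lemma ridge_step_limit:
  fixes h :: "real \<Rightarrow> real ^ 'm \<Rightarrow> real"
  assumes y: "y $ j0 = 1"
    and h: "\<And>s a b. a < b \<Longrightarrow> (\<lambda>x. h s x * indicator {a..<b} (y \<bullet> x)) \<in> V"
    and decay: "\<And>s x. x \<in> strip j0 \<Longrightarrow> \<bar>h s x\<bar> \<le> K / (1 + \<bar>s\<bar>)"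
    and cont: "\<And>x. x \<in> strip j0 \<Longrightarrow> continuous_on UNIV (\<lambda>s. h s x)"
  shows "(\<lambda>x. h (y \<bullet> x) x) \<in> V"
proof -
  define q where "q n t = of_int \<lfloor>real (Suc n) * t\<rfloor> / real (Suc n)" for n t
  \<comment> \<open>The grid cells of width \<open>1 / Suc n\<close> with index in
    \<open>I n\<close> cover \<open>[-Suc n, Suc n)\<close>, so they exhaust the line while each sum
    stays finite.\<close>
  define I where "I n = {- int (Suc n * Suc n)..<int (Suc n * Suc n)}" for n
  define F where "F n x = (\<Sum>k\<in>I n. h (of_int k / real (Suc n)) x *
      indicator {of_int k / real (Suc n)..<(of_int k + 1) / real (Suc n)} (y \<bullet> x))" for n x
  have F_eq: "F n x = (if \<lfloor>real (Suc n) * (y \<bullet> x)\<rfloor> \<in> I n then h (q n (y \<bullet> x)) x else 0)" for n x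
  proof -
    have "indicator {of_int k / real (Suc n)..<(of_int k + 1) / real (Suc n)} (y \<bullet> x)
        = (of_bool (\<lfloor>real (Suc n) * (y \<bullet> x)\<rfloor> = k) :: real)" for k
      by (simp add: indicator_def floor_eq_iff pos_divide_le_eq pos_less_divide_eq mult.commute)
    then have "F n x = (\<Sum>k\<in>I n. if \<lfloor>real (Suc n) * (y \<bullet> x)\<rfloor> = k then h (of_int k / real (Suc n)) x else 0)"
      unfolding F_def by (intro sum.cong) auto
    also have "\<dots> = (if \<lfloor>real (Suc n) * (y \<bullet> x)\<rfloor> \<in> I n then h (q n (y \<bullet> x)) x else 0)"
      by (subst sum.delta') (auto simp: I_def q_def)
    finally show ?thesis .
  qed
  have V: "F n \<in> V" for n
    unfolding F_def by (intro V_sum h) (simp add: divide_strict_right_mono)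
  have q_close: "\<bar>q n t - t\<bar> \<le> 1 / real (Suc n)" for n t
  proof -
    have "\<bar>of_int \<lfloor>real (Suc n) * t\<rfloor> - real (Suc n) * t\<bar> \<le> 1" by linarith
    then have "\<bar>of_int \<lfloor>real (Suc n) * t\<rfloor> - real (Suc n) * t\<bar> / real (Suc n) \<le> 1 / real (Suc n)"
      by (intro divide_right_mono) auto
    moreover have "q n t - t = (of_int \<lfloor>real (Suc n) * t\<rfloor> - real (Suc n) * t) / real (Suc n)"
      by (simp add: q_def field_simps)
    ultimately show ?thesis by simp
  qed
  have q_lim: "(\<lambda>n. q n t) \<longlonglongrightarrow> t" for t
  proof -
    have "(\<lambda>n. q n t - t) \<longlonglongrightarrow> 0"
      by (rule Lim_null_comparison[OF _ LIMSEQ_Suc[OF lim_1_over_n]])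
         (use q_close in \<open>auto intro!: always_eventually\<close>)
    then show ?thesis by (rule LIM_zero_cancel)
  qed
  show ?thesis
  proof (rule V_dominated_ridge[OF V y])
    fix n x assume x: "x \<in> strip j0"
    have K: "0 \<le> K" using decay[OF x, of 0] by simp
    have "\<bar>q n (y \<bullet> x) - y \<bullet> x\<bar> \<le> 1"
      by (rule order_trans[OF q_close]) simp
    \<comment> \<open>Rounding moves the ridge variable by at most 1, which costs a factor of 2 in
      the decay.\<close>
    moreover have "1 + \<bar>t\<bar> \<le> 2 * (1 + \<bar>s\<bar>)" if "\<bar>s - t\<bar> \<le> 1" for s t :: real
      using that by (auto simp: abs_if split: if_splits)
    ultimately have "1 + \<bar>y \<bullet> x\<bar> \<le> 2 * (1 + \<bar>q n (y \<bullet> x)\<bar>)" by blast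
    then have "K * (1 + \<bar>y \<bullet> x\<bar>) \<le> K * (2 * (1 + \<bar>q n (y \<bullet> x)\<bar>))"
      using K by (rule mult_left_mono)
    then have "K / (1 + \<bar>q n (y \<bullet> x)\<bar>) \<le> 2 * K / (1 + \<bar>y \<bullet> x\<bar>)"
      by (simp add: pos_divide_le_eq pos_le_divide_eq add_pos_nonneg mult_ac)
    moreover have "0 \<le> 2 * K / (1 + \<bar>y \<bullet> x\<bar>)" using K by simp
    ultimately show "\<bar>F n x\<bar> \<le> 2 * K / (1 + \<bar>y \<bullet> x\<bar>)"
      unfolding F_eq using decay[OF x, of "q n (y \<bullet> x)"] by auto
  next
    fix x assume x: "x \<in> strip j0"
    obtain n0 where n0: "\<bar>y \<bullet> x\<bar> < real n0" using reals_Archimedean2 by blast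
    have "\<forall>\<^sub>F n in sequentially. h (q n (y \<bullet> x)) x = F n x"
    proof (rule eventually_sequentiallyI[of n0])
      fix n assume "n0 \<le> n"
      then have t: "\<bar>y \<bullet> x\<bar> < real (Suc n)" using n0 by linarith
      have "\<bar>real (Suc n) * (y \<bullet> x)\<bar> < real (Suc n) * real (Suc n)"
        unfolding abs_mult using t by (simp del: of_nat_Suc)
      then have "\<lfloor>real (Suc n) * (y \<bullet> x)\<rfloor> \<in> I n"
        by (simp only: I_def atLeastLessThan_iff le_floor_iff floor_less_iff of_int_minus
            of_int_mult of_int_of_nat_eq of_nat_mult) linarith
      then show "h (q n (y \<bullet> x)) x = F n x" by (simp add: F_eq)
    qed
    moreover have "(\<lambda>n. h (q n (y \<bullet> x)) x) \<longlonglongrightarrow> h (y \<bullet> x) x"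
      using continuous_on_tendsto_compose[OF cont[OF x] q_lim] by simp
    ultimately show "(\<lambda>n. F n x) \<longlonglongrightarrow> h (y \<bullet> x) x"
      by (rule Lim_transform_eventually[rotated])
  qed
qed

text \<open>These are bounded multipliers that keep ridge indicators in \<open>V\<close>. All
  directions \<open>y\<close> are required at once because \<open>weight_mult_coord\<close> compares
  neighbouring ridge vectors.\<close>

definition weight :: "(real ^ 'm \<Rightarrow> real) \<Rightarrow> bool" where
  "weight u \<longleftrightarrow> (\<exists>B. \<forall>x \<in> strip j0. \<bar>u x\<bar> \<le> B) \<and>
     (\<forall>y a b. y $ j0 = 1 \<longrightarrow> a < b \<longrightarrow> (\<lambda>x. u x * indicator {a..<b} (y \<bullet> x)) \<in> V)"

lemma weight_one: "weight (\<lambda>x. 1)"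
  unfolding weight_def using ridge_indicator_in_V by auto

lemma weight_add:
  assumes "weight u" "weight v"
  shows "weight (\<lambda>x. u x + v x)"
proof -
  obtain A B where "\<forall>x \<in> strip j0. \<bar>u x\<bar> \<le> A" "\<forall>x \<in> strip j0. \<bar>v x\<bar> \<le> B"
    using assms by (auto simp: weight_def)
  then have "\<forall>x \<in> strip j0. \<bar>u x + v x\<bar> \<le> A + B"
    by (meson abs_triangle_ineq add_mono order_trans)
  then show ?thesis
    using assms unfolding weight_def by (auto simp: distrib_right intro: V_add)
qed

lemma weight_scale:
  assumes "weight u"
  shows "weight (\<lambda>x. c * u x)"
proof -
  obtain B where "\<forall>x \<in> strip j0. \<bar>u x\<bar> \<le> B" using assms by (auto simp: weight_def)
  then have "\<forall>x \<in> strip j0. \<bar>c * u x\<bar> \<le> \<bar>c\<bar> * B" by (auto simp: abs_mult intro: mult_left_mono)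
  then show ?thesis
    using assms unfolding weight_def by (auto simp: mult.assoc intro: V_scale)
qed

lemma weight_zero: "weight (\<lambda>x. 0)"
  using weight_scale[OF weight_one, of 0] by simp

lemma weight_sum: "(\<And>i. i \<in> I \<Longrightarrow> weight (f i)) \<Longrightarrow> weight (\<lambda>x. \<Sum>i\<in>I. f i x)"
  by (induction I rule: infinite_finite_induct) (auto simp: weight_zero intro: weight_add)

text \<open>Differentiating a ridge function in the direction \<open>e\<^sub>j\<close> of its ridge vector \<open>y\<close> produces
  the factor \<open>x\<^sub>j\<close>. The profile has to be the derivative of a compactly supported function,
  hence of mean zero, so a mean-compensating plateau of length \<open>N\<close> and height \<open>(b - a) / N\<close>
  is subtracted. It tends to \<open>0\<close> with the majorant \<open>const / (1 + \<bar>y \<bullet> x\<bar>)\<close>, which lies in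
  \<open>L\<^sup>p\<close> since \<open>p > 1\<close>.\<close>

lemma weight_mult_coord:
  assumes u: "weight u" and j: "j \<noteq> j0"
  shows "weight (\<lambda>x. x $ j * u x)"
proof -
  obtain B0 where B0: "\<And>x. x \<in> strip j0 \<Longrightarrow> \<bar>u x\<bar> \<le> B0" using u unfolding weight_def by blast
  define B where "B = \<bar>B0\<bar>"
  have B: "\<bar>u x\<bar> \<le> B" if "x \<in> strip j0" for x using B0[OF that] by (simp add: B_def)
  have B_nn: "0 \<le> B" by (simp add: B_def)
  have xj: "0 \<le> x $ j" "x $ j \<le> 1" if "x \<in> strip j0" for x using that j by (auto simp: strip_def)
  have ind: "(\<lambda>x. u x * indicator {a..<b} (y \<bullet> x)) \<in> V" if "y $ j0 = 1" "a < b" for y a b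
    using u that by (simp add: weight_def)
  have "(\<lambda>x. x $ j * u x * indicator {a..<b} (y \<bullet> x)) \<in> V" if y: "y $ j0 = 1" and ab: "a < b" for y a b
  proof -
    \<comment> \<open>\<open>G N\<close> is an antiderivative of \<open>g N\<close>. At
      \<open>b + N\<close> the second ramp has height \<open>N\<close>, so both terms equal
      \<open>b - a\<close> and cancel: \<open>G N\<close> vanishes outside
      \<open>[a, b + N]\<close>.\<close>
    define G where "G N t = ramp a b t - (b - a) / N * ramp b (b + N) t" for N t
    define g where "g N t = indicator {a..<b} t - (b - a) / N * indicator {b..<b + N} t" for N t :: real
    have G_V: "(\<lambda>x. u x * G N (z \<bullet> x)) \<in> V" if N: "1 \<le> N" and z: "z $ j0 = 1" for N z
    proof (rule ridge_step_limit[OF z])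
      show "(\<lambda>x. u x * G N s * indicator {a'..<b'} (z \<bullet> x)) \<in> V" if "a' < b'" for s a' b'
        using V_scale[OF ind[OF z that], of "G N s"] by (simp add: mult_ac)
      show "continuous_on UNIV (\<lambda>s. u x * G N s)" for x
        unfolding G_def ramp_def by (intro continuous_intros)
      fix s x assume x: "x \<in> strip j0"
      have r1: "0 \<le> ramp a b s \<and> ramp a b s \<le> b - a" using ab by (auto simp: ramp_def)
      have r2: "0 \<le> (b - a) / N * ramp b (b + N) s \<and> (b - a) / N * ramp b (b + N) s \<le> (b - a) / N * N"
        using ab N by (intro conjI mult_nonneg_nonneg mult_left_mono) (auto simp: ramp_def)
      have "\<bar>G N s\<bar> \<le> b - a" using r1 r2 N by (auto simp: G_def abs_le_iff)
      then have bd: "\<bar>u x * G N s\<bar> \<le> B * (b - a)"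
        unfolding abs_mult using B[OF x] B_nn by (intro mult_mono) auto
      show "\<bar>u x * G N s\<bar> \<le> B * (b - a) * (1 + (\<bar>a\<bar> + \<bar>b\<bar> + N)) / (1 + \<bar>s\<bar>)"
      proof (rule supported_decay[OF bd])
        assume s: "\<bar>s\<bar> > \<bar>a\<bar> + \<bar>b\<bar> + N"
        show "u x * G N s = 0"
        proof (cases "s > 0")
          case True
          have "s - b \<ge> N" "s - a \<ge> b - a" using s True N by linarith+
          then show ?thesis using ab N by (simp add: G_def ramp_def)
        next
          case False
          have "s - b \<le> 0" "s - a \<le> 0" using s False N by linarith+
          then show ?thesis using ab N by (simp add: G_def ramp_def)
        qed
      qed (use N in simp)
    qed
    have g_V: "(\<lambda>x. u x * (x $ j * g N (y \<bullet> x))) \<in> V" if N: "1 \<le> N" for N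
    proof -
      \<comment> \<open>Difference quotient in the ridge vector. Since \<open>j \<noteq> j0\<close>,
        the perturbed vector still has coordinate 1 at \<open>j0\<close>, so \<open>G_V\<close>
        applies to it.\<close>
      let ?Q = "\<lambda>k x. real (Suc k) * (u x * G N ((y + axis j (1 / real (Suc k))) \<bullet> x))
          + (- real (Suc k)) * (u x * G N (y \<bullet> x))"
      \<comment> \<open>Both ramp quotients lie in \<open>[0, 1]\<close>, as ramps are 1-Lipschitz
        and \<open>x $ j \<le> 1\<close>. The extra 1 in the radius accounts for the shift
        \<open>d \<le> 1\<close>.\<close>
      let ?K = "B * (1 + (b - a) / N) * (1 + (1 + \<bar>a\<bar> + \<bar>b\<bar> + N))"
      have c_nn: "0 \<le> (b - a) / N" using ab N by simp
      have V: "?Q k \<in> V" for k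
        by (rule V_add; rule V_scale; rule G_V) (use N y j in \<open>auto simp: axis_def\<close>)
      have Q: "?Q k x = u x *
          (real (Suc k) * (ramp a b (y \<bullet> x + x $ j / real (Suc k)) - ramp a b (y \<bullet> x))
           - (b - a) / N * (real (Suc k) *
              (ramp b (b + N) (y \<bullet> x + x $ j / real (Suc k)) - ramp b (b + N) (y \<bullet> x))))" for k x
      proof -
        have arg: "(y + axis j (1 / real (Suc k))) \<bullet> x = y \<bullet> x + x $ j / real (Suc k)"
          by (simp add: inner_add_left inner_axis')
        have "K * (v * (\<alpha> - c * \<beta>)) + (- K) * (v * (\<alpha>' - c * \<beta>'))
            = v * (K * (\<alpha> - \<alpha>') - c * (K * (\<beta> - \<beta>')))" for K v c \<alpha> \<alpha>' \<beta> \<beta>' :: real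
          by (simp add: algebra_simps)
        then show ?thesis unfolding G_def arg .
      qed
      have lim: "(\<lambda>k. ?Q k x) \<longlonglongrightarrow> u x * (x $ j * g N (y \<bullet> x))" if x: "x \<in> strip j0" for x
      proof -
        have "(\<lambda>k. ?Q k x) \<longlonglongrightarrow> u x * (x $ j * indicator {a..<b} (y \<bullet> x)
            - (b - a) / N * (x $ j * indicator {b..<b + N} (y \<bullet> x)))"
          unfolding Q
          by (intro tendsto_intros difference_quotient_ramp) (use xj[OF x] N ab in auto)
        moreover have "u x * (x $ j * indicator {a..<b} (y \<bullet> x)
            - (b - a) / N * (x $ j * indicator {b..<b + N} (y \<bullet> x))) = u x * (x $ j * g N (y \<bullet> x))"
          unfolding g_def right_diff_distrib by (simp only: mult.left_commute)
        ultimately show ?thesis by (simp only:)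
      qed
      have dom: "\<bar>?Q k x\<bar> \<le> ?K / (1 + \<bar>y \<bullet> x\<bar>)" if x: "x \<in> strip j0" for k x
      proof -
        note s = xj[OF x]
        define d where "d = x $ j / real (Suc k)"
        define t where "t = y \<bullet> x"
        have d: "0 \<le> d" "real (Suc k) * d \<le> 1" using s by (simp_all add: d_def)
        have "real (Suc k) * d \<ge> 1 * d" using d by (intro mult_right_mono) auto
        then have d1: "d \<le> 1" using d by linarith
        have quot: "0 \<le> real (Suc k) * (ramp a' b' (t + d) - ramp a' b' t) \<and>
            real (Suc k) * (ramp a' b' (t + d) - ramp a' b' t) \<le> 1" for a' b'
        proof -
          have le: "real (Suc k) * (ramp a' b' (t + d) - ramp a' b' t) \<le> real (Suc k) * d"
            using ramp_mono_lipschitz[OF d(1), of a' b' t] by (intro mult_left_mono) auto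
          show ?thesis
            using ramp_mono_lipschitz[OF d(1), of a' b' t]
            by (intro conjI mult_nonneg_nonneg order_trans[OF le d(2)]) auto
        qed
        have est: "\<bar>v * (e - c * e')\<bar> \<le> B * (1 + c)"
          if "\<bar>v\<bar> \<le> B" "0 \<le> e \<and> e \<le> 1" "0 \<le> e' \<and> e' \<le> 1" "0 \<le> c" for v e e' c
        proof -
          have "0 \<le> c * e'" "c * e' \<le> c" using that by (auto intro: mult_left_le)
          then have "\<bar>e - c * e'\<bar> \<le> 1 + c" using that by linarith
          then show ?thesis unfolding abs_mult using that B_nn by (intro mult_mono) auto
        qed
        have "\<bar>u x * (real (Suc k) * (ramp a b (t + d) - ramp a b t)
              - (b - a) / N * (real (Suc k) * (ramp b (b + N) (t + d) - ramp b (b + N) t)))\<bar>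
            \<le> ?K / (1 + \<bar>t\<bar>)"
        proof (rule supported_decay[OF est[OF B[OF x] quot quot c_nn]])
          assume t: "\<bar>t\<bar> > 1 + \<bar>a\<bar> + \<bar>b\<bar> + N"
          have "ramp a b (t + d) = ramp a b t" "ramp b (b + N) (t + d) = ramp b (b + N) t"
          proof (atomize (full), cases "t > 0")
            case True
            then have "b + N \<le> t" using t by linarith
            then show "ramp a b (t + d) = ramp a b t \<and> ramp b (b + N) (t + d) = ramp b (b + N) t"
              using d(1) N ab by (simp add: ramp_def)
          next
            case False
            then have "t + d \<le> a" "t + d \<le> b" using t d1 N by linarith+
            then show "ramp a b (t + d) = ramp a b t \<and> ramp b (b + N) (t + d) = ramp b (b + N) t"
              using d(1) N ab by (simp add: ramp_def)
          qed
          then show "u x * (real (Suc k) * (ramp a b (t + d) - ramp a b t)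
              - (b - a) / N * (real (Suc k) * (ramp b (b + N) (t + d) - ramp b (b + N) t))) = 0"
            by simp
        qed (use N in simp)
        then show ?thesis by (simp only: Q t_def d_def)
      qed
      show ?thesis
        by (rule V_dominated_ridge[where F = ?Q and K = ?K, OF V y dom lim])
    qed
    show ?thesis
    proof (rule V_dominated_ridge[OF g_V y])
      show "1 \<le> real (Suc n)" for n by simp
      fix x assume x: "x \<in> strip j0"
      note s = xj[OF x]
      have "(\<lambda>n. u x * (x $ j * (indicator {a..<b} (y \<bullet> x)
          - (b - a) / real (Suc n) * indicator {b..<b + real (Suc n)} (y \<bullet> x))))
        \<longlonglongrightarrow> u x * (x $ j * (indicator {a..<b} (y \<bullet> x) - 0))"
      proof (intro tendsto_intros)
        show "(\<lambda>n. (b - a) / real (Suc n) * indicator {b..<b + real (Suc n)} (y \<bullet> x)) \<longlonglongrightarrow> 0"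
          by (rule Lim_null_comparison[OF _ LIMSEQ_Suc[OF lim_const_over_n[of "b - a"]]])
             (use ab in \<open>auto simp: indicator_def intro!: always_eventually\<close>)
      qed
      then show "(\<lambda>n. u x * (x $ j * g (real (Suc n)) (y \<bullet> x)))
          \<longlonglongrightarrow> x $ j * u x * indicator {a..<b} (y \<bullet> x)"
        by (simp add: g_def mult_ac)
      fix n
      define N where "N = real (Suc n)"
      define t where "t = y \<bullet> x"
      have N: "1 \<le> N" by (simp add: N_def)
      have i1: "\<bar>indicator {a..<b} t :: real\<bar> \<le> 1 * (1 + (\<bar>a\<bar> + \<bar>b\<bar>)) / (1 + \<bar>t\<bar>)"
        by (rule supported_decay) (auto simp: indicator_def)
      \<comment> \<open>Uniform in \<open>N\<close>: on the plateau \<open>1 + \<bar>t\<bar> \<le> 1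
        + \<bar>b\<bar> + N \<le> (2 + \<bar>b\<bar>) * N\<close>, so the height
        \<open>(b - a) / N\<close> is within the claimed decay.\<close>
      have i2: "\<bar>(b - a) / N * indicator {b..<b + N} t\<bar> \<le> (b - a) * (2 + \<bar>b\<bar>) / (1 + \<bar>t\<bar>)"
      proof (cases "t \<in> {b..<b + N}")
        case True
        have "\<bar>b\<bar> * 1 \<le> \<bar>b\<bar> * N" using N by (intro mult_left_mono) auto
        then have "1 + \<bar>t\<bar> \<le> (2 + \<bar>b\<bar>) * N" using True N by (auto simp: distrib_right)
        then have "(b - a) * (1 + \<bar>t\<bar>) \<le> (b - a) * ((2 + \<bar>b\<bar>) * N)"
          using ab by (intro mult_left_mono) auto
        then have "(b - a) / N \<le> (b - a) * (2 + \<bar>b\<bar>) / (1 + \<bar>t\<bar>)"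
          using N by (simp add: pos_divide_le_eq pos_le_divide_eq add_pos_nonneg mult_ac)
        then show ?thesis using True ab N by simp
      qed (use ab in simp)
      have "\<bar>g N t\<bar> \<le> (1 + (\<bar>a\<bar> + \<bar>b\<bar>)) / (1 + \<bar>t\<bar>) + (b - a) * (2 + \<bar>b\<bar>) / (1 + \<bar>t\<bar>)"
        using i1 i2 unfolding g_def by (intro order_trans[OF abs_triangle_ineq4] add_mono) auto
      then have "\<bar>g N t\<bar> \<le> (1 + (\<bar>a\<bar> + \<bar>b\<bar>) + (b - a) * (2 + \<bar>b\<bar>)) / (1 + \<bar>t\<bar>)"
        by (simp only: add_divide_distrib)
      then have "1 * \<bar>g N t\<bar> \<le> 1 * ((1 + (\<bar>a\<bar> + \<bar>b\<bar>) + (b - a) * (2 + \<bar>b\<bar>)) / (1 + \<bar>t\<bar>))"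
        by simp
      then have "B * (\<bar>x $ j\<bar> * \<bar>g N t\<bar>)
          \<le> B * (1 * ((1 + (\<bar>a\<bar> + \<bar>b\<bar>) + (b - a) * (2 + \<bar>b\<bar>)) / (1 + \<bar>t\<bar>)))"
        using s B_nn by (intro mult_left_mono mult_mono) auto
      moreover have "\<bar>u x * (x $ j * g N t)\<bar> \<le> B * (\<bar>x $ j\<bar> * \<bar>g N t\<bar>)"
        unfolding abs_mult using B[OF x] by (intro mult_right_mono) auto
      ultimately show "\<bar>u x * (x $ j * g (real (Suc n)) (y \<bullet> x))\<bar>
          \<le> B * (1 + (\<bar>a\<bar> + \<bar>b\<bar>) + (b - a) * (2 + \<bar>b\<bar>)) / (1 + \<bar>y \<bullet> x\<bar>)"
        by (simp add: N_def t_def)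
    qed
  qed
  moreover have "\<bar>x $ j * u x\<bar> \<le> B" if "x \<in> strip j0" for x
    using xj[OF that] mult_mono[of "\<bar>x $ j\<bar>" 1 "\<bar>u x\<bar>" B] B[OF that] by (simp add: abs_mult)
  ultimately show ?thesis unfolding weight_def by blast
qed

text \<open>The weight \<open>u\<close> is kept arbitrary so that in the product case the hypothesis
  for \<open>f\<close> applies to the weight obtained from \<open>g\<close>. Linear functions reduce
  to \<open>weight_mult_coord\<close>; the coordinate \<open>j0\<close> contributes 0.\<close>

lemma weight_polynomial:
  assumes "real_polynomial_function P" "weight u"
  shows "weight (\<lambda>x. P (zero_coord j0 x) * u x)"
  using assms
proof (induction arbitrary: u rule: real_polynomial_function.induct)
  case (linear f)
  have "f (zero_coord j0 x) = (\<Sum>j\<in>UNIV. zero_coord j0 x $ j * f (axis j 1))" for x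
  proof -
    have "f (zero_coord j0 x) = f (\<Sum>j\<in>UNIV. zero_coord j0 x $ j *\<^sub>R axis j 1)"
      by (simp add: basis_expansion flip: scalar_mult_eq_scaleR)
    also have "\<dots> = (\<Sum>j\<in>UNIV. zero_coord j0 x $ j * f (axis j 1))"
      using linear(1) by (simp add: linear_sum linear_cmul bounded_linear.linear)
    finally show ?thesis .
  qed
  then have eq: "(\<lambda>x. f (zero_coord j0 x) * u x)
      = (\<lambda>x. \<Sum>j\<in>UNIV. f (axis j 1) * (zero_coord j0 x $ j * u x))"
    by (simp add: sum_distrib_left sum_distrib_right mult_ac)
  have "weight (\<lambda>x. zero_coord j0 x $ j * u x)" for j
    using weight_mult_coord[OF linear(2)] weight_zero by (cases "j = j0") (auto simp: zero_coord_def)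
  then show ?case unfolding eq by (intro weight_sum weight_scale)
next
  case (const c)
  then show ?case by (rule weight_scale)
next
  case (add f g)
  from weight_add[OF add.IH(1)[OF add.prems] add.IH(2)[OF add.prems]]
  show ?case by (simp only: distrib_right)
next
  case (mult f g)
  from mult.IH(1)[OF mult.IH(2)[OF mult.prems]] show ?case by (simp only: mult.assoc)
qed

section \<open>From polynomial weights to all of \<open>L^p\<close>\<close>

lemma weight_continuous:
  assumes w: "continuous_on UNIV w"
  shows "weight (\<lambda>x. w (zero_coord j0 x))"
proof -
  \<comment> \<open>A compact box, degenerate in direction \<open>j0\<close>, that contains the
    projection of the strip; it makes Stone-Weierstrass available.\<close>
  let ?S = "cbox 0 (\<chi> j. if j = j0 then 0 else 1) :: (real ^ 'm) set"
  have S: "zero_coord j0 x \<in> ?S" if "x \<in> strip j0" for x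
    using that by (auto simp: mem_box_cart zero_coord_def strip_def)
  have cont: "continuous_on ?S w" using w continuous_on_subset by blast
  have "compact (w ` ?S)" by (intro compact_continuous_image cont compact_cbox)
  then obtain B where B: "\<And>z. z \<in> ?S \<Longrightarrow> \<bar>w z\<bar> \<le> B"
    using compact_imp_bounded[of "w ` ?S"] unfolding bounded_iff by auto
  have "\<exists>P. real_polynomial_function P \<and> (\<forall>z\<in>?S. \<bar>w z - P z\<bar> < 1 / real (Suc n))" for n
    by (rule Stone_Weierstrass_real_polynomial_function[OF compact_cbox cont, of "1 / real (Suc n)"]) auto
  then obtain P where P: "\<And>n. real_polynomial_function (P n)"
      and wP: "\<And>n z. z \<in> ?S \<Longrightarrow> \<bar>w z - P n z\<bar> < 1 / real (Suc n)"
    by metis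
  have "(\<lambda>x. w (zero_coord j0 x) * indicator {a..<b} (y \<bullet> x)) \<in> V" if y: "y $ j0 = 1" and ab: "a < b" for y a b
  proof (rule V_dominated_ridge[OF _ y])
    show "(\<lambda>x. P n (zero_coord j0 x) * indicator {a..<b} (y \<bullet> x)) \<in> V" for n
      using weight_polynomial[OF P weight_one, of n] y ab by (simp add: weight_def)
    fix x assume x: "x \<in> strip j0"
    have "(\<lambda>n. w (zero_coord j0 x) - P n (zero_coord j0 x)) \<longlonglongrightarrow> 0"
      by (rule Lim_null_comparison[OF _ LIMSEQ_Suc[OF lim_1_over_n]])
         (use wP[OF S[OF x]] in \<open>auto intro!: always_eventually less_imp_le\<close>)
    from tendsto_diff[OF tendsto_const[of "w (zero_coord j0 x)"] this]
    have "(\<lambda>n. P n (zero_coord j0 x)) \<longlonglongrightarrow> w (zero_coord j0 x)" by simp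
    then show "(\<lambda>n. P n (zero_coord j0 x) * indicator {a..<b} (y \<bullet> x))
        \<longlonglongrightarrow> w (zero_coord j0 x) * indicator {a..<b} (y \<bullet> x)"
      by (intro tendsto_intros)
    fix n
    have "1 / real (Suc n) \<le> 1" by simp
    then have "\<bar>P n (zero_coord j0 x)\<bar> \<le> B + 1"
      using wP[OF S[OF x], of n] B[OF S[OF x]] by linarith
    then show "\<bar>P n (zero_coord j0 x) * indicator {a..<b} (y \<bullet> x)\<bar>
        \<le> (B + 1) * (1 + (\<bar>a\<bar> + \<bar>b\<bar>)) / (1 + \<bar>y \<bullet> x\<bar>)"
      by (intro supported_decay) (auto simp: indicator_def)
  qed
  then show ?thesis unfolding weight_def using B S by blast
qed

text \<open>Splitting \<open>x\<close> into \<open>zero_coord j0 x\<close> and its \<open>j0\<close>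
  coordinate \<open>s\<close>, each frozen \<open>s\<close> gives a continuous weight.
  \<open>ridge_step_limit\<close> with ridge vector \<open>axis j0 1\<close> then puts
  \<open>x $ j0\<close> back in place of \<open>s\<close>.\<close>

lemma continuous_decaying_in_V:
  assumes f: "continuous_on UNIV f" and decay: "\<And>x. \<bar>f x\<bar> \<le> K / (1 + \<bar>x $ j0\<bar>)"
  shows "f \<in> V"
proof -
  let ?h = "\<lambda>s x. f (zero_coord j0 x + axis j0 s)"
  have "(\<lambda>x. ?h (axis j0 1 \<bullet> x) x) \<in> V"
  proof (rule ridge_step_limit)
    show "(axis j0 1 :: real ^ 'm) $ j0 = 1" by simp
    show "(\<lambda>x. ?h s x * indicator {a..<b} (axis j0 1 \<bullet> x)) \<in> V" if "a < b" for s a b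
    proof -
      have "continuous_on UNIV (\<lambda>z. f (z + axis j0 s))"
        by (intro continuous_on_compose2[OF f] continuous_intros) auto
      from weight_continuous[OF this] show ?thesis using that by (simp add: weight_def)
    qed
    show "\<bar>?h s x\<bar> \<le> K / (1 + \<bar>s\<bar>)" for s x
      using decay[of "zero_coord j0 x + axis j0 s"] by (simp add: zero_coord_def)
    show "continuous_on UNIV (\<lambda>s. ?h s x)" for x
    proof (intro continuous_on_compose2[OF f] continuous_intros)
      have eq: "axis j0 = (\<lambda>s::real. s *\<^sub>R (axis j0 1 :: real ^ 'm))"
        by (auto simp: axis_def vec_eq_iff)
      show "continuous_on UNIV (axis j0 :: real \<Rightarrow> real ^ 'm)"
        by (subst eq) (intro continuous_intros)
    qed auto
  qed
  moreover have "zero_coord j0 x + axis j0 (axis j0 1 \<bullet> x) = x" for x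
    unfolding inner_axis' by (auto simp: vec_eq_iff zero_coord_def axis_def)
  ultimately show ?thesis by simp
qed

text \<open>A measurable function is almost everywhere a limit of continuous ones. Clamping these to
  the majorant makes \<open>continuous_decaying_in_V\<close> applicable and leaves the limit
  unchanged, since \<open>f\<close> obeys the same bound.\<close>

lemma Lp_fun_decaying_in_V:
  assumes f: "f \<in> borel_measurable (lebesgue_on (strip j0))"
    and decay: "\<And>x. \<bar>f x\<bar> \<le> K / (1 + \<bar>x $ j0\<bar>)"
  shows "f \<in> V"
proof -
  obtain N g where N: "negligible N" and g: "\<And>n. continuous_on UNIV (g n)"
    and lim: "\<And>x. x \<notin> N \<Longrightarrow> (\<lambda>n. g n x) \<longlonglongrightarrow> (if x \<in> strip j0 then f x else 0)"
    using f measurable_on_iff_borel_measurable[OF strip_lebesgue] unfolding measurable_on_def by metis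
  let ?m = "\<lambda>x. K / (1 + \<bar>x $ j0\<bar>)"
  let ?F = "\<lambda>n x. max (- ?m x) (min (?m x) (g n x))"
  have K: "0 \<le> K" using decay[of 0] by simp
  have bound: "\<bar>?F n x\<bar> \<le> ?m x" for n x
  proof -
    have "0 \<le> ?m x" using K by simp
    then show ?thesis by linarith
  qed
  show ?thesis
  proof (rule Lp_closure_dominated[where F = ?F and G = ?m])
    show "1 \<le> p" using p by simp
    show "?F n \<in> V" for n
    proof (rule continuous_decaying_in_V[OF _ bound])
      show "continuous_on UNIV (?F n)"
        by (intro continuous_intros g) (auto simp: add_nonneg_eq_0_iff)
    qed
    show "?m \<in> Lp_fun p (lebesgue_on (strip j0))" by (rule strip_decay_Lp[OF p])
    have "AE x in lebesgue. x \<notin> N" using N by (intro AE_not_in) (simp add: negligible_iff_null_sets)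
    then have "AE x in lebesgue_on (strip j0). x \<notin> N"
      by (auto simp: AE_restrict_space_iff elim: eventually_mono)
    then show "AE x in lebesgue_on (strip j0). (\<lambda>n. ?F n x) \<longlonglongrightarrow> f x"
      using AE_space
    proof eventually_elim
      case (elim x)
      then show ?case using lim[of x] clamp_tendsto[OF _ decay] by (simp add: space_restrict_space)
    qed
  qed (use bound f in auto)
qed

text \<open>Truncation at a growing multiple of the decay: it is dominated by
  \<open>\<bar>f x\<bar>\<close> and at each point eventually equal to \<open>f x\<close>.\<close>

lemma Lp_fun_in_V:
  assumes f: "f \<in> Lp_fun p (lebesgue_on (strip j0))"
  shows "f \<in> V"
proof -
  let ?m = "\<lambda>n x. real n / (1 + \<bar>x $ j0\<bar>)"
  let ?F = "\<lambda>n x. max (- ?m n x) (min (?m n x) (f x))"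
  have fm [measurable]: "f \<in> borel_measurable (lebesgue_on (strip j0))" using f by (simp add: Lp_fun_def)
  have mm [measurable]: "?m n \<in> borel_measurable (lebesgue_on (strip j0))" for n
    using strip_decay_Lp[OF p, of "real n" j0] by (simp add: Lp_fun_def)
  have nn: "0 \<le> ?m n x" for n x by simp
  show ?thesis
  proof (rule Lp_closure_dominated[where F = ?F and G = "\<lambda>x. \<bar>f x\<bar>"])
    show "1 \<le> p" using p by simp
    show "?F n \<in> V" for n
    proof (rule Lp_fun_decaying_in_V)
      show "?F n \<in> borel_measurable (lebesgue_on (strip j0))" by measurable
      show "\<bar>?F n x\<bar> \<le> ?m n x" for x using nn[of n x] by linarith
    qed
    show "(\<lambda>x. \<bar>f x\<bar>) \<in> Lp_fun p (lebesgue_on (strip j0))" using f by (simp add: Lp_fun_def)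
    show "\<bar>?F n x\<bar> \<le> \<bar>f x\<bar>" for n x using nn[of n x] by linarith
    have "(\<lambda>n. ?F n x) \<longlonglongrightarrow> f x" for x
    proof (rule tendsto_eventually)
      obtain n0 where n0: "\<bar>f x\<bar> * (1 + \<bar>x $ j0\<bar>) \<le> real n0" using real_arch_simple by blast
      show "\<forall>\<^sub>F n in sequentially. ?F n x = f x"
      proof (rule eventually_sequentiallyI[of n0])
        fix n assume "n0 \<le> n"
        then have "\<bar>f x\<bar> * (1 + \<bar>x $ j0\<bar>) \<le> real n" using n0 by linarith
        then have "\<bar>f x\<bar> \<le> ?m n x" by (simp add: pos_le_divide_eq add_pos_nonneg)
        then show "?F n x = f x" by linarith
      qed
    qed
    then show "AE x in lebesgue_on (strip j0). (\<lambda>n. ?F n x) \<longlonglongrightarrow> f x" by simp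
  qed (use fm in auto)
qed

end

section \<open>Activation functions\<close>

lemma exp_minus_le: "0 \<le> (s::real) \<Longrightarrow> exp (- s) \<le> 1 / (1 + s)"
  using exp_ge_add_one_self[of s] by (simp add: exp_minus divide_simps)

text \<open>The error vanishes unless the kink lies strictly between \<open>s\<close> and
  \<open>s + 1\<close>; there \<open>supported_decay\<close> with radius 1 yields the factor
  2.\<close>

lemma LeakyReLU_increment:
  "\<bar>LeakyReLU \<alpha> (s + 1) - LeakyReLU \<alpha> s - (if 0 \<le> s then 1 else \<alpha>)\<bar> \<le> 2 * \<bar>1 - \<alpha>\<bar> / (1 + \<bar>s\<bar>)"
proof -
  consider "0 \<le> s" | "s \<le> - 1" | "-1 < s" "s < 0" by linarith
  then show ?thesis
  proof cases
    case 3
    have "LeakyReLU \<alpha> (s + 1) - LeakyReLU \<alpha> s - \<alpha> = (1 - \<alpha>) * (s + 1)"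
      using 3 by (auto simp: LeakyReLU_def algebra_simps)
    also have "\<bar>\<dots>\<bar> \<le> \<bar>1 - \<alpha>\<bar> * (1 + 1) / (1 + \<bar>s\<bar>)"
    proof (rule supported_decay)
      show "\<bar>(1 - \<alpha>) * (s + 1)\<bar> \<le> \<bar>1 - \<alpha>\<bar>"
        unfolding abs_mult using 3 by (intro mult_left_le) auto
    qed (use 3 in auto)
    finally show ?thesis using 3 by (simp add: mult_ac)
  qed (auto simp: LeakyReLU_def algebra_simps)
qed

text \<open>The first term of the constant stems from the window around the kink, the second from
  the exponential tail on the left.\<close>

lemma ELU_increment:
  "\<bar>ELU \<alpha> (s + 1) - ELU \<alpha> s - (if 0 \<le> s then 1 else 0)\<bar>
    \<le> (2 * (1 + \<bar>\<alpha>\<bar>) + \<bar>\<alpha>\<bar> * (exp 1 - 1)) / (1 + \<bar>s\<bar>)"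
proof -
  have e: "0 \<le> \<bar>\<alpha>\<bar> * (exp 1 - 1)" by simp
  consider "0 \<le> s" | "s \<le> - 1" | "-1 < s" "s < 0" by linarith
  then show ?thesis
  proof cases
    case 1
    then show ?thesis using e by (auto simp: ELU_def)
  next
    case 2
    have "ELU \<alpha> (s + 1) - ELU \<alpha> s = \<alpha> * (exp 1 - 1) * exp s"
      using 2 by (simp add: ELU_def exp_add algebra_simps)
    also have "\<bar>\<dots>\<bar> = \<bar>\<alpha>\<bar> * (exp 1 - 1) * exp s" by (simp add: abs_mult)
    also have "\<dots> \<le> \<bar>\<alpha>\<bar> * (exp 1 - 1) * (1 / (1 + \<bar>s\<bar>))"
      using exp_minus_le[of "- s"] 2 by (intro mult_left_mono) auto
    also have "\<dots> \<le> (2 * (1 + \<bar>\<alpha>\<bar>) + \<bar>\<alpha>\<bar> * (exp 1 - 1)) / (1 + \<bar>s\<bar>)"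
      by (simp add: divide_right_mono)
    finally show ?thesis using 2 by simp
  next
    case 3
    have "\<bar>\<alpha> * (exp s - 1)\<bar> \<le> \<bar>\<alpha>\<bar>"
      unfolding abs_mult using 3 by (intro mult_left_le) auto
    then have "\<bar>ELU \<alpha> (s + 1) - ELU \<alpha> s\<bar> \<le> 1 + \<bar>\<alpha>\<bar>"
      using 3 by (auto simp: ELU_def)
    then have "\<bar>ELU \<alpha> (s + 1) - ELU \<alpha> s\<bar> \<le> (1 + \<bar>\<alpha>\<bar>) * (1 + 1) / (1 + \<bar>s\<bar>)"
      using 3 by (intro supported_decay) auto
    also have "\<dots> \<le> (2 * (1 + \<bar>\<alpha>\<bar>) + \<bar>\<alpha>\<bar> * (exp 1 - 1)) / (1 + \<bar>s\<bar>)"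
      using e by (intro divide_right_mono) auto
    finally show ?thesis using 3 by simp
  qed
qed

lemma Softplus_increment:
  "\<bar>Softplus (s + 1) - Softplus s - (if 0 \<le> s then 1 else 0)\<bar> \<le> exp 1 / (1 + \<bar>s\<bar>)"
proof -
  have pos: "0 \<le> Softplus t" "Softplus t \<le> exp t" for t
    using ln_add_one_self_le_self[of "exp t"] by (auto simp: Softplus_def add.commute)
  \<comment> \<open>This reflection carries the error for \<open>s \<ge> 0\<close> over to the
    negative side, where Softplus is at most the exponential.\<close>
  have refl: "Softplus t = t + Softplus (- t)" for t
  proof -
    have "exp t + 1 = exp t * (exp (- t) + 1)" by (simp add: distrib_left flip: exp_add)
    moreover have "0 < exp (- t) + 1" by (simp add: add_pos_pos)
    ultimately show ?thesis by (simp add: Softplus_def ln_mult_pos)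
  qed
  have mono: "Softplus t \<le> Softplus t'" if "t \<le> t'" for t t' :: real
    using that by (simp add: Softplus_def add_pos_pos)
  have "\<bar>Softplus (s + 1) - Softplus s - (if 0 \<le> s then 1 else 0)\<bar> \<le> exp 1 * exp (- \<bar>s\<bar>)"
  proof (cases "0 \<le> s")
    case True
    have "Softplus (s + 1) - Softplus s - 1 = Softplus (- (s + 1)) - Softplus (- s)"
      using refl[of "s + 1"] refl[of s] by simp
    moreover have "\<bar>Softplus (- (s + 1)) - Softplus (- s)\<bar> \<le> exp (- s)"
      using mono[of "- (s + 1)" "- s"] pos(2)[of "- s"] pos(1)[of "- (s + 1)"] by auto
    moreover have "1 * exp (- s) \<le> exp 1 * exp (- s)" by (intro mult_right_mono) auto
    ultimately have "\<bar>Softplus (s + 1) - Softplus s - 1\<bar> \<le> exp 1 * exp (- s)" by linarith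
    then show ?thesis using True by simp
  next
    case False
    have "\<bar>Softplus (s + 1) - Softplus s\<bar> \<le> exp (s + 1)"
      using mono[of s "s + 1"] pos(2)[of "s + 1"] pos(1)[of s] by auto
    then show ?thesis using False by (simp add: exp_add mult_ac)
  qed
  also have "\<dots> \<le> exp 1 * (1 / (1 + \<bar>s\<bar>))"
    using exp_minus_le[of "\<bar>s\<bar>"] by (intro mult_left_mono) auto
  finally show ?thesis by simp
qed

theorem theorem3p8:
  fixes n :: nat and p :: real and \<phi> :: "real \<Rightarrow> real" and j\<^sub>0 :: "'m :: finite"
    and M :: "(real ^ 'm) measure"
  assumes "CARD('m) = n + 1"
    and "2 \<le> p"
    and "\<phi> = ReLU \<or> (\<exists>\<alpha>. \<phi> = ELU \<alpha>) \<or> \<phi> = Softplus \<or> (\<exists>\<alpha>. \<alpha> \<noteq> 1 \<and> \<phi> = LeakyReLU \<alpha>)"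
    and "M = lebesgue_on (strip j\<^sub>0)"
  shows "Lp_topology p M closure_of (Lp_class p M ` (shallow_nets \<phi> \<inter> Lp_fun p M)) = Lp_space p M"
proof -
  have dense: ?thesis if "strip_network p \<phi> l r C" for l r C
  proof -
    interpret strip_network p j\<^sub>0 \<phi> l r C by (rule that)
    show ?thesis
      unfolding assms(4) using p Lp_fun_in_V by (intro closure_of_eq_Lp_space) auto
  qed
  have leaky: ?thesis if "\<alpha> \<noteq> 1" "\<phi> = LeakyReLU \<alpha>" for \<alpha>
  \<comment> \<open>The two slopes are \<open>\<alpha>\<close> and 1, so the jump condition is
    exactly \<open>\<alpha> \<noteq> 1\<close>.\<close>
  proof (rule dense[of \<alpha> 1 "2 * \<bar>1 - \<alpha>\<bar>"], unfold_locales)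
    show "\<phi> \<in> borel_measurable borel" unfolding that(2) LeakyReLU_def by measurable
  qed (use assms(2) that LeakyReLU_increment in auto)
  have "ReLU = LeakyReLU 0" by (auto simp: ReLU_def LeakyReLU_def)
  then consider \<alpha> where "\<alpha> \<noteq> 1" "\<phi> = LeakyReLU \<alpha>" | \<alpha> where "\<phi> = ELU \<alpha>" | "\<phi> = Softplus"
    using assms(3) by (metis zero_neq_one)
  then show ?thesis
  proof cases
    case 1
    then show ?thesis by (rule leaky)
  next
    case (2 \<alpha>)
    show ?thesis
    \<comment> \<open>The left branch is bounded, so the left slope is 0 for every
      \<open>\<alpha>\<close>.\<close>
    proof (rule dense[of 0 1 "2 * (1 + \<bar>\<alpha>\<bar>) + \<bar>\<alpha>\<bar> * (exp 1 - 1)"], unfold_locales)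
      show "\<phi> \<in> borel_measurable borel" unfolding 2 ELU_def by measurable
    qed (use assms(2) 2 ELU_increment in auto)
  next
    case 3
    show ?thesis
    proof (rule dense[of 0 1 "exp 1"], unfold_locales)
      show "\<phi> \<in> borel_measurable borel" unfolding 3 Softplus_def by measurable
    qed (use assms(2) 3 Softplus_increment in auto)
  qed
qed

end
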